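(* Let $\lambda\in[0,1)$ and $\delta>0$. For the push policy with arrival rate $\lambda$ and probe rate $\delta$, the maximum queue length $\lceil\tilde m\rceil$ of the queue at the cavity is such that $$\left\lceil\frac1\delta\log\left(1+\frac1\delta\,\frac{\lambda}{1-\lambda}(e^\delta-1)\right)\right\rceil\le\lceil\tilde m\rceil\le\left\lceil\frac{\lambda}{(1-\lambda)\delta}\right\rceil$$ for any phase-type job size distribution (with mean $1$), and these bounds are tight.
   Context: Job sizes: $Z$ has a phase-type (PH) distribution $(\alpha,S)$, where $\alpha$ is a probability row vector of length $n_s$, $S$ is an invertible $n_s\times n_s$ subgenerator matrix, $s^*=-S\mathbf 1$ ($\mathbf 1$ the all-ones column), $P[Z>t]=\alpha e^{St}\mathbf 1$, and $E[Z]=\alpha(-S)^{-1}\mathbf 1=1$. Let $y=\alpha(\delta I-S)^{-1}s^*=P[Z<X]$ with $X$ exponential of rate $\delta$ independent of $Z$, and $$\tilde m=\frac{\log\left(\frac1y+\left(\frac{\lambda}{\delta(1-\lambda)}-1\right)\frac{1-y}{y}\right)}{\log(1/y)} .$$ The queue at the cavity of the push policy: for an integer $m\ge 0$ and a real $\nu\ge 0$, consider the continuous-time Markov chain on the states $(0,e)$ and $(q,e,j)$ with $e\in\{m,m+1\}$, $1\le q\le e$, $1\le j\le n_s$ ($q$ = actual queue length, $e$ = queue length estimated by the dispatcher, $j$ = service phase), with transitions: (i) $(q,e,j)\to(q,e,j')$ at rate $S_{jj'}$ for $j\ne j'$; (ii) $(q,e,j)\to(q-1,e,j')$ at rate $s^*_j\alpha_{j'}$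 if $q\ge2$, and $(1,e,j)\to(0,e)$ at rate $s^*_j$; (iii) $(q,e,j)\to(\max(q,m),\max(q,m),j)$ at rate $\delta$, and $(0,e)\to(m,m,j')$ at rate $\delta\alpha_{j'}$ if $m\ge1$ (if $m=0$: $(0,e)\to(0,0)$ at rate $\delta$); (iv) $(q,m,j)\to(q+1,m+1,j)$ at rate $\nu$ for $q\ge1$, and $(0,m)\to(1,m+1,j')$ at rate $\nu\alpha_{j'}$. Let $\pi_q(m,\nu)$ be the stationary probability that the actual queue length is $q$. The queue at the cavity is the stationary chain for the unique pair $(m,\nu)$, $m\in\{0,1,\dots\}$, $\nu\in[0,\infty)$, with $\pi_0(m,\nu)=1-\lambda$; its maximum queue length equals $\lceil\tilde m\rceil$.
   Formalization: Tightness: the upper bound is attained; the lower bound is attained unless its unrounded argument L is an integer ≥ 2, where m̃ > L strictly for every phase-type size so attainment is false; there only m̃ → L is claimed. *)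

theory Defs
  imports Complex_Main "Jordan_Normal_Form.Gauss_Jordan_Elimination"
begin

definition ones :: "nat \<Rightarrow> real vec" where
  "ones n = vec n (\<lambda>_. 1)"

definition subgenerator :: "nat \<Rightarrow> real mat \<Rightarrow> bool" where
  "subgenerator n S \<longleftrightarrow> S \<in> carrier_mat n n
     \<and> (\<forall>i<n. \<forall>j<n. i \<noteq> j \<longrightarrow> 0 \<le> S $$ (i, j))
     \<and> (\<forall>i<n. (\<Sum>j<n. S $$ (i, j)) \<le> 0)"

definition probability_vec :: "nat \<Rightarrow> real vec \<Rightarrow> bool" where
  "probability_vec n \<alpha> \<longleftrightarrow> \<alpha> \<in> carrier_vec n \<and> (\<forall>i<n. 0 \<le> \<alpha> $ i) \<and> (\<Sum>i<n. \<alpha> $ i) = 1"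

text \<open>\<open>(\<alpha>, S)\<close> are the parameters of a phase-type distribution with phases \<open>0, \<dots>, n - 1\<close>,
  that is, of the absorption time \<open>Z\<close> of a Markov chain with \<open>P[Z > t] = \<alpha> exp (S t) 1\<close>.\<close>

definition phase_type :: "nat \<Rightarrow> real vec \<Rightarrow> real mat \<Rightarrow> bool" where
  "phase_type n \<alpha> S \<longleftrightarrow> probability_vec n \<alpha> \<and> subgenerator n S \<and> invertible_mat S"

definition exit_rates :: "nat \<Rightarrow> real mat \<Rightarrow> real vec" where
  "exit_rates n S = - (S *\<^sub>v ones n)"

definition ph_mean :: "nat \<Rightarrow> real vec \<Rightarrow> real mat \<Rightarrow> real" where
  "ph_mean n \<alpha> S = \<alpha> \<bullet> (the (mat_inverse (- S)) *\<^sub>v ones n)"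

text \<open>\<open>P[Z < X]\<close> for an independent exponential \<open>X\<close> of rate \<open>\<delta>\<close>, i.e. the Laplace transform of
  \<open>Z\<close> at \<open>\<delta>\<close>.\<close>

definition ph_beats_probe :: "real \<Rightarrow> nat \<Rightarrow> real vec \<Rightarrow> real mat \<Rightarrow> real" where
  "ph_beats_probe \<delta> n \<alpha> S =
     \<alpha> \<bullet> (the (mat_inverse (\<delta> \<cdot>\<^sub>m 1\<^sub>m n - S)) *\<^sub>v exit_rates n S)"

definition m_tilde :: "real \<Rightarrow> real \<Rightarrow> nat \<Rightarrow> real vec \<Rightarrow> real mat \<Rightarrow> real" where
  "m_tilde lam \<delta> n \<alpha> S =
     (let y = ph_beats_probe \<delta> n \<alpha> S
      in ln (1 / y + (lam / (\<delta> * (1 - lam)) - 1) * ((1 - y) / y)) / ln (1 / y))"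

text \<open>\<open>Idle e\<close> is the state \<open>(0, e)\<close> and \<open>Busy q e j\<close> is the state \<open>(q, e, j)\<close>: actual queue length
  \<open>q\<close>, queue length \<open>e\<close> as estimated by the dispatcher, and service phase \<open>j\<close>.\<close>

datatype cavity_state = Idle nat | Busy nat nat nat

fun queue_length :: "cavity_state \<Rightarrow> nat" where
  "queue_length (Idle e) = 0"
| "queue_length (Busy q e j) = q"

definition cavity_states :: "nat \<Rightarrow> nat \<Rightarrow> cavity_state set" where
  "cavity_states n m = {Idle e | e. e \<in> {m, m + 1}}
     \<union> {Busy q e j | q e j. e \<in> {m, m + 1} \<and> 1 \<le> q \<and> q \<le> e \<and> j < n}"

text \<open>Transition rates. Some probe transitions lead from a state to itself; these entries cancel
  in the balance equations below.\<close>

fun cavity_rate ::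
  "nat \<Rightarrow> real vec \<Rightarrow> real mat \<Rightarrow> real \<Rightarrow> nat \<Rightarrow> real \<Rightarrow> cavity_state \<Rightarrow> cavity_state \<Rightarrow> real" where
  "cavity_rate n \<alpha> S \<delta> m \<nu> (Busy q e j) (Busy q' e' j') =
     (if q' = q \<and> e' = e \<and> j' \<noteq> j then S $$ (j, j') else 0)
   + (if 2 \<le> q \<and> q' = q - 1 \<and> e' = e then exit_rates n S $ j * \<alpha> $ j' else 0)
   + (if q' = max q m \<and> e' = max q m \<and> j' = j then \<delta> else 0)
   + (if e = m \<and> q' = q + 1 \<and> e' = m + 1 \<and> j' = j then \<nu> else 0)"
| "cavity_rate n \<alpha> S \<delta> m \<nu> (Busy q e j) (Idle e') =
     (if q = 1 \<and> e' = e then exit_rates n S $ j else 0)"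
| "cavity_rate n \<alpha> S \<delta> m \<nu> (Idle e) (Busy q' e' j') =
     (if 1 \<le> m \<and> q' = m \<and> e' = m then \<delta> * \<alpha> $ j' else 0)
   + (if e = m \<and> q' = 1 \<and> e' = m + 1 then \<nu> * \<alpha> $ j' else 0)"
| "cavity_rate n \<alpha> S \<delta> m \<nu> (Idle e) (Idle e') =
     (if m = 0 \<and> e' = 0 then \<delta> else 0)"

definition stationary_distribution ::
  "'s set \<Rightarrow> ('s \<Rightarrow> 's \<Rightarrow> real) \<Rightarrow> ('s \<Rightarrow> real) \<Rightarrow> bool" where
  "stationary_distribution X r \<pi> \<longleftrightarrow>
     (\<forall>x\<in>X. 0 \<le> \<pi> x) \<and> (\<Sum>x\<in>X. \<pi> x) = 1
     \<and> (\<forall>x\<in>X. (\<Sum>z\<in>X. \<pi> z * r z x) = \<pi> x * (\<Sum>z\<in>X. r x z))"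

definition queue_length_prob :: "nat \<Rightarrow> nat \<Rightarrow> (cavity_state \<Rightarrow> real) \<Rightarrow> nat \<Rightarrow> real" where
  "queue_length_prob n m \<pi> q = (\<Sum>x\<in>{x \<in> cavity_states n m. queue_length x = q}. \<pi> x)"

definition queue_at_the_cavity ::
  "real \<Rightarrow> real \<Rightarrow> nat \<Rightarrow> real vec \<Rightarrow> real mat \<Rightarrow> nat \<Rightarrow> real \<Rightarrow> (cavity_state \<Rightarrow> real) \<Rightarrow> bool" where
  "queue_at_the_cavity lam \<delta> n \<alpha> S m \<nu> \<pi> \<longleftrightarrow> 0 \<le> \<nu>
     \<and> stationary_distribution (cavity_states n m) (cavity_rate n \<alpha> S \<delta> m \<nu>) \<pi>
     \<and> queue_length_prob n m \<pi> 0 = 1 - lam"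

definition max_queue_length :: "nat \<Rightarrow> nat \<Rightarrow> (cavity_state \<Rightarrow> real) \<Rightarrow> nat" where
  "max_queue_length n m \<pi> = Max {q. 0 < queue_length_prob n m \<pi> q}"

end

(*
  Write X = 1 / y and U = lam / ((1 - lam) delta), so that m_tilde = log_X (1 + U (X - 1)).

  Testing the stationary distribution against one well-chosen function, linear in the vectors
  w = (-S)^-1 1 and g = (delta - S)^-1 s*, gives
    1 + U (X - 1) = (pi(0, m) X^m + pi(0, m + 1) X^(m + 1)) / (1 - lam),
  so the ceiling of m_tilde is m if pi(0, m + 1) = 0 and m + 1 otherwise; and pi(0, m + 1) > 0
  holds iff queue length m + 1 has positive probability.

  For U <= 1 all ceilings equal that of U. For U >= 1 the map X |-> log_X (1 + U (X - 1)) is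
  nonincreasing on X > 1, with limit U at 1, and Jensen's inequality gives 1 < X <= exp delta, where
  the value at exp delta is L. Erlang distributions approach X = exp delta and two-phase
  hyperexponential ones approach X = 1.
*)
theory Submission
  imports Defs "Jordan_Normal_Form.Determinant" "HOL-Analysis.Convex" "HOL-Real_Asymp.Real_Asymp"
begin

section \<open>Linear systems of subgenerators\<close>

lemma mat_inverse_invertible:
  fixes A :: "real mat"
  assumes A: "A \<in> carrier_mat n n" and inv: "invertible_mat A"
  shows "the (mat_inverse A) \<in> carrier_mat n n"
    and "A * the (mat_inverse A) = 1\<^sub>m n"
    and "the (mat_inverse A) * A = 1\<^sub>m n"
proof -
  obtain B where B: "A * B = 1\<^sub>m n" "B * A = 1\<^sub>m (dim_row B)"
    using inv A by (auto simp: invertible_mat_def inverts_mat_def)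
  then have Bc: "B \<in> carrier_mat n n"
    using A by (metis carrier_matD carrier_matI index_mult_mat(2,3) index_one_mat(2,3))
  then have "A \<in> Units (ring_mat TYPE(real) n ())"
    using A B by (auto simp: Units_def ring_mat_simps)
  then obtain C where "mat_inverse A = Some C"
    using mat_inverse(1)[OF A, of "()"] by fastforce
  with mat_inverse(2)[OF A this] show "the (mat_inverse A) \<in> carrier_mat n n"
    "A * the (mat_inverse A) = 1\<^sub>m n" "the (mat_inverse A) * A = 1\<^sub>m n" by auto
qed

lemma mat_inverse_mult_vec:
  fixes A :: "real mat"
  assumes A: "A \<in> carrier_mat n n" and inv: "invertible_mat A"
    and v: "v \<in> carrier_vec n" and b: "b \<in> carrier_vec n"
  shows "A *\<^sub>v v = b \<longleftrightarrow> v = the (mat_inverse A) *\<^sub>v b"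
proof
  note B = mat_inverse_invertible[OF A inv]
  assume "A *\<^sub>v v = b"
  then show "v = the (mat_inverse A) *\<^sub>v b"
    using assoc_mult_mat_vec[OF B(1) A v] B(3) v by simp
next
  note B = mat_inverse_invertible[OF A inv]
  assume "v = the (mat_inverse A) *\<^sub>v b"
  then show "A *\<^sub>v v = b"
    using assoc_mult_mat_vec[OF A B(1) b] B(2) b by simp
qed

lemma invertible_mat_if_trivial_kernel:
  fixes A :: "real mat"
  assumes A: "A \<in> carrier_mat n n"
    and "\<And>v. v \<in> carrier_vec n \<Longrightarrow> A *\<^sub>v v = 0\<^sub>v n \<Longrightarrow> v = 0\<^sub>v n"
  shows "invertible_mat A"
proof -
  have "det A \<noteq> 0"
    using assms det_0_iff_vec_prod_zero_field[OF A] by blast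
  from det_non_zero_imp_unit[OF A this, of "()"] show ?thesis
    using A by (auto simp: Units_def ring_mat_simps invertible_mat_def inverts_mat_def)
qed

lemma mult_mat_vec_eq_iff:
  assumes "A \<in> carrier_mat n n" and "v \<in> carrier_vec n" and "b \<in> carrier_vec n"
  shows "A *\<^sub>v v = b \<longleftrightarrow> (\<forall>i<n. (\<Sum>j<n. A $$ (i, j) * v $ j) = b $ i)"
  using assms by (auto simp: vec_eq_iff scalar_prod_def lessThan_atLeast0)

lemma resolvent_mult_vec_index:
  fixes S :: "real mat"
  assumes "S \<in> carrier_mat n n" and "v \<in> carrier_vec n" and "i < n"
  shows "(\<Sum>j<n. (\<delta> \<cdot>\<^sub>m 1\<^sub>m n - S) $$ (i, j) * v $ j) = \<delta> * v $ i - (\<Sum>j<n. S $$ (i, j) * v $ j)"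
proof -
  have "(\<Sum>j<n. (\<delta> \<cdot>\<^sub>m 1\<^sub>m n - S) $$ (i, j) * v $ j)
      = (\<Sum>j<n. (if j = i then \<delta> * v $ i else 0) - S $$ (i, j) * v $ j)"
    using assms by (intro sum.cong) (auto simp: algebra_simps)
  then show ?thesis using assms by (simp add: sum_subtractf)
qed

lemma exit_rates_index:
  assumes "S \<in> carrier_mat n n" and "i < n"
  shows "exit_rates n S $ i = - (\<Sum>j<n. S $$ (i, j))"
  using assms by (simp add: exit_rates_def ones_def scalar_prod_def lessThan_atLeast0)

lemma exit_rates_carrier [simp]: "S \<in> carrier_mat n n \<Longrightarrow> exit_rates n S \<in> carrier_vec n"
  by (auto simp: exit_rates_def ones_def)

lemma subgenerator_max_principle:
  fixes v :: "nat \<Rightarrow> real"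
  assumes S: "subgenerator n S" and "0 < \<delta>" and "i < n"
    and v: "\<And>i. i < n \<Longrightarrow> 0 \<le> \<delta> * v i - (\<Sum>j<n. S $$ (i, j) * v j)"
  shows "0 \<le> v i"
    and "(\<And>i. i < n \<Longrightarrow> 0 < \<delta> * v i - (\<Sum>j<n. S $$ (i, j) * v j)) \<Longrightarrow> 0 < v i"
proof -
  have "Min (v ` {..<n}) \<in> v ` {..<n}" using \<open>i < n\<close> by (intro Min_in) auto
  then obtain k where k: "k < n" "v k = Min (v ` {..<n})" by auto
  then have min: "v k \<le> v j" if "j < n" for j using that by simp
  have "S $$ (k, j) * v k \<le> S $$ (k, j) * v j" if "j < n" for j
    using S k(1) min[OF that] that
    by (cases "j = k") (auto simp: subgenerator_def intro: mult_left_mono)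
  then have "(\<Sum>j<n. S $$ (k, j) * v k) \<le> (\<Sum>j<n. S $$ (k, j) * v j)"
    by (intro sum_mono) auto
  then have *: "\<delta> * v k - (\<Sum>j<n. S $$ (k, j) * v j) \<le> v k * (\<delta> - (\<Sum>j<n. S $$ (k, j)))"
    by (simp add: sum_distrib_left algebra_simps)
  have "0 < \<delta> - (\<Sum>j<n. S $$ (k, j))"
    using S k(1) \<open>0 < \<delta>\<close> by (fastforce simp: subgenerator_def)
  note pos = this
  have "0 \<le> v k * (\<delta> - (\<Sum>j<n. S $$ (k, j)))" using * v[OF k(1)] by linarith
  then have "0 \<le> v k" using pos by (simp add: zero_le_mult_iff)
  then show "0 \<le> v i" using min[OF \<open>i < n\<close>] by linarith
  assume "\<And>i. i < n \<Longrightarrow> 0 < \<delta> * v i - (\<Sum>j<n. S $$ (i, j) * v j)"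
  then have "0 < v k * (\<delta> - (\<Sum>j<n. S $$ (k, j)))" using * k(1) by fastforce
  then have "0 < v k" using pos by (simp add: zero_less_mult_iff)
  then show "0 < v i" using min[OF \<open>i < n\<close>] by linarith
qed

lemma resolvent_invertible:
  assumes S: "subgenerator n S" and "0 < \<delta>"
  shows "invertible_mat (\<delta> \<cdot>\<^sub>m 1\<^sub>m n - S)"
proof (rule invertible_mat_if_trivial_kernel)
  have Sc: "S \<in> carrier_mat n n" using S by (simp add: subgenerator_def)
  show A: "\<delta> \<cdot>\<^sub>m 1\<^sub>m n - S \<in> carrier_mat n n" using Sc by auto
  fix v :: "real vec" assume v: "v \<in> carrier_vec n" "(\<delta> \<cdot>\<^sub>m 1\<^sub>m n - S) *\<^sub>v v = 0\<^sub>v n"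
  then have *: "\<delta> * v $ i - (\<Sum>j<n. S $$ (i, j) * v $ j) = 0" if "i < n" for i
    using that by (subst (asm) mult_mat_vec_eq_iff[OF A]) (auto simp: resolvent_mult_vec_index[OF Sc])
  have "0 \<le> v $ i" if "i < n" for i
    using * by (intro subgenerator_max_principle(1)[OF assms that, of "\<lambda>i. v $ i"]) auto
  moreover have "0 \<le> - v $ i" if "i < n" for i
    using * by (intro subgenerator_max_principle(1)[OF assms that, of "\<lambda>i. - v $ i"])
      (auto simp: sum_negf)
  ultimately have "v $ i = 0" if "i < n" for i using that by fastforce
  then show "v = 0\<^sub>v n" using v(1) by (intro eq_vecI) auto
qed

lemma exp_ge_tangent: "exp (- c) * (1 + c - z) \<le> exp (- z :: real)"
proof -
  have "exp (- c) * (1 + c - z) \<le> exp (- c) * exp (c - z)"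
    using exp_ge_add_one_self[of "c - z"] by (intro mult_left_mono) (auto simp: algebra_simps)
  also have "\<dots> = exp (- z)" by (simp flip: exp_add)
  finally show ?thesis .
qed

text \<open>Jensen's inequality \<open>E exp (- \<delta> Z) \<ge> exp (- c) (1 + c - \<delta> E Z)\<close> for the absorption time from
  each phase. With \<open>\<theta>\<close> a uniformisation rate and \<open>r = \<theta> / (\<theta> + \<delta>)\<close>, the vector \<open>v k\<close> below is the
  expectation of the nonnegative quantity \<open>r ^ N - exp (- c) (1 + c - \<delta> N / \<theta>)\<close>, where \<open>N\<close> is
  \<open>k\<close> plus the number of steps to absorption; hence \<open>v k \<ge> 0\<close> follows from \<open>v (k + 1) \<ge> 0\<close>.\<close>

lemma subgenerator_laplace_ge_tangent:
  fixes g w :: "nat \<Rightarrow> real"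
  assumes S: "subgenerator n S" and \<delta>: "0 < \<delta>" and i: "i < n"
    and g: "\<And>i. i < n \<Longrightarrow> \<delta> * g i - (\<Sum>j<n. S $$ (i, j) * g j) = - (\<Sum>j<n. S $$ (i, j))"
    and w: "\<And>i. i < n \<Longrightarrow> (\<Sum>j<n. S $$ (i, j) * w j) = - 1"
  shows "exp (- c) * (1 + c - \<delta> * w i) \<le> g i"
proof -
  define \<theta> where "\<theta> = 1 + (\<Sum>i<n. \<bar>S $$ (i, i)\<bar>)"
  have \<theta>: "0 < \<theta>" unfolding \<theta>_def by (intro add_pos_nonneg sum_nonneg) auto
  have diag: "0 \<le> \<theta> + S $$ (i, i)" if "i < n" for i
  proof -
    have "\<bar>S $$ (i, i)\<bar> \<le> (\<Sum>i<n. \<bar>S $$ (i, i)\<bar>)" using that by (intro member_le_sum) auto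
    then show ?thesis by (simp add: \<theta>_def)
  qed
  define r where "r = \<theta> / (\<theta> + \<delta>)"
  have r: "0 < r" "r < 1" "r * (\<theta> + \<delta>) = \<theta>" using \<theta> \<delta> by (auto simp: r_def)
  define \<phi> where "\<phi> k = r ^ k - exp (- c) * (1 + c - \<delta> * (real k / \<theta>))" for k
  define v where "v k i = r ^ k * g i - exp (- c) * (1 + c - \<delta> * (real k / \<theta> + w i))" for k i
  have "exp (- \<delta> / \<theta>) \<le> r"
  proof -
    have "1 / r = 1 + \<delta> / \<theta>" using \<theta> \<delta> by (simp add: r_def field_simps)
    also have "\<dots> \<le> exp (\<delta> / \<theta>)" by (rule exp_ge_add_one_self)
    finally show ?thesis using r by (simp add: exp_minus field_simps)
  qed
  have \<phi>: "0 \<le> \<phi> k" for k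
  proof -
    have "exp (- c) * (1 + c - \<delta> * (real k / \<theta>)) \<le> exp (- (\<delta> * (real k / \<theta>)))"
      by (rule exp_ge_tangent)
    also have "\<dots> = exp (- \<delta> / \<theta>) ^ k" by (simp flip: exp_of_nat_mult)
    also have "\<dots> \<le> r ^ k" by (intro power_mono \<open>exp (- \<delta> / \<theta>) \<le> r\<close>) auto
    finally show ?thesis by (simp add: \<phi>_def)
  qed
  have rec: "\<theta> * v k i = (- (\<Sum>j<n. S $$ (i, j))) * \<phi> (Suc k)
      + (\<theta> * v (Suc k) i + (\<Sum>j<n. S $$ (i, j) * v (Suc k) j))" if i: "i < n" for k i
  proof -
    define s where "s = - (\<Sum>j<n. S $$ (i, j))"
    have "(\<Sum>j<n. S $$ (i, j) * v (Suc k) j)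
        = (\<Sum>j<n. r ^ Suc k * (S $$ (i, j) * g j)
            + exp (- c) * \<delta> * (S $$ (i, j) * w j)
            - exp (- c) * (1 + c - \<delta> * (real (Suc k) / \<theta>)) * S $$ (i, j))"
      unfolding v_def by (intro sum.cong) (simp_all add: algebra_simps)
    also have "\<dots> = r ^ Suc k * (\<Sum>j<n. S $$ (i, j) * g j) + exp (- c) * \<delta> * (\<Sum>j<n. S $$ (i, j) * w j)
            - exp (- c) * (1 + c - \<delta> * (real (Suc k) / \<theta>)) * (\<Sum>j<n. S $$ (i, j))"
      by (simp add: sum.distrib sum_subtractf sum_distrib_left)
    also have "(\<Sum>j<n. S $$ (i, j) * g j) = \<delta> * g i - s" using g[OF i] by (simp add: s_def)
    also have "(\<Sum>j<n. S $$ (i, j) * w j) = -1" by (rule w[OF i])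
    finally have eq: "(\<Sum>j<n. S $$ (i, j) * v (Suc k) j) = r ^ Suc k * (\<delta> * g i - s)
        - exp (- c) * \<delta> + exp (- c) * (1 + c - \<delta> * (real (Suc k) / \<theta>)) * s"
      by (simp add: s_def)
    have "s * \<phi> (Suc k) + (\<theta> * v (Suc k) i + (\<Sum>j<n. S $$ (i, j) * v (Suc k) j))
       = r ^ k * (r * (\<theta> + \<delta>)) * g i
         - exp (- c) * (\<theta> * (1 + c - \<delta> * w i) - \<delta> * real (Suc k) * (\<theta> / \<theta>) + \<delta>)"
      unfolding eq unfolding \<phi>_def v_def by (simp add: algebra_simps add_divide_distrib)
    also have "\<dots> = \<theta> * v k i"
      unfolding r(3) v_def using \<theta> by (simp add: algebra_simps)
    finally show ?thesis by (simp add: s_def)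
  qed
  have step: "\<forall>i<n. 0 \<le> v k i" if IH: "\<forall>i<n. 0 \<le> v (Suc k) i" for k
  proof (intro allI impI)
    fix i assume i: "i < n"
    have "\<theta> * v (Suc k) i + (\<Sum>j<n. S $$ (i, j) * v (Suc k) j)
       = (\<theta> + S $$ (i, i)) * v (Suc k) i + (\<Sum>j\<in>{..<n} - {i}. S $$ (i, j) * v (Suc k) j)"
      using i by (subst sum.remove[of _ i]) (auto simp: algebra_simps)
    also have "0 \<le> \<dots>"
      using IH i S
      by (intro add_nonneg_nonneg mult_nonneg_nonneg[OF diag[OF i]] sum_nonneg)
        (auto simp: subgenerator_def intro!: mult_nonneg_nonneg)
    finally have "0 \<le> \<theta> * v (Suc k) i + (\<Sum>j<n. S $$ (i, j) * v (Suc k) j)" .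
    moreover have "0 \<le> (- (\<Sum>j<n. S $$ (i, j))) * \<phi> (Suc k)"
      using S i \<phi> by (intro mult_nonneg_nonneg) (auto simp: subgenerator_def)
    ultimately have "0 \<le> \<theta> * v k i" using rec[OF i, of k] by linarith
    then show "0 \<le> v k i" using \<theta> by (simp add: zero_le_mult_iff)
  qed
  define B where "B = (\<Sum>i<n. \<bar>g i\<bar> + exp (- c) * (\<bar>1 + c\<bar> + \<delta> * \<bar>w i\<bar>))"
  obtain K :: nat where K: "B * \<theta> / (exp (- c) * \<delta>) < real K" using reals_Archimedean2 by blast
  have "\<forall>i<n. 0 \<le> v K i"
  proof (intro allI impI)
    fix i assume i: "i < n"
    have "\<bar>g i\<bar> + exp (- c) * (\<bar>1 + c\<bar> + \<delta> * \<bar>w i\<bar>) \<le> B"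
      unfolding B_def using i \<delta>
      by (intro member_le_sum[of i "{..<n}" "\<lambda>i. \<bar>g i\<bar> + exp (- c) * (\<bar>1 + c\<bar> + \<delta> * \<bar>w i\<bar>)"]) auto
    moreover have "B \<le> exp (- c) * (\<delta> * (real K / \<theta>))"
      using K \<theta> \<delta> by (simp add: field_simps)
    moreover have "- \<bar>g i\<bar> \<le> r ^ K * g i"
    proof -
      have "\<bar>r ^ K * g i\<bar> \<le> 1 * \<bar>g i\<bar>"
        unfolding abs_mult using r by (intro mult_right_mono) (auto simp: power_le_one)
      then show ?thesis by linarith
    qed
    moreover have "exp (- c) * (1 + c - \<delta> * w i) \<le> exp (- c) * (\<bar>1 + c\<bar> + \<delta> * \<bar>w i\<bar>)"
    proof (intro mult_left_mono)
      have "\<delta> * - w i \<le> \<delta> * \<bar>w i\<bar>" using \<delta> by (intro mult_left_mono) auto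
      then show "1 + c - \<delta> * w i \<le> \<bar>1 + c\<bar> + \<delta> * \<bar>w i\<bar>" by auto
    qed auto
    moreover have "v K i = r ^ K * g i - exp (- c) * (1 + c - \<delta> * w i) + exp (- c) * (\<delta> * (real K / \<theta>))"
      by (simp add: v_def algebra_simps)
    ultimately show "0 \<le> v K i" by linarith
  qed
  then have "\<forall>i<n. 0 \<le> v 0 i"
    by (induction K) (use step in blast)+
  then show ?thesis using i by (simp add: v_def)
qed

lemma scalar_prod_vec_sum:
  "\<alpha> \<in> carrier_vec n \<Longrightarrow> \<alpha> \<bullet> vec n f = (\<Sum>i<n. \<alpha> $ i * f i)"
  by (simp add: scalar_prod_def lessThan_atLeast0)

lemma invertible_uminus_mat:
  fixes S :: "real mat"
  assumes S: "S \<in> carrier_mat n n" and inv: "invertible_mat S"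
  shows "invertible_mat (- S)"
proof (rule invertible_mat_if_trivial_kernel)
  show "- S \<in> carrier_mat n n" using S by simp
  fix v :: "real vec" assume v: "v \<in> carrier_vec n" and "- S *\<^sub>v v = 0\<^sub>v n"
  then have "S *\<^sub>v v = 0\<^sub>v n"
    using S v by (simp add: mult_mat_vec_eq_iff[of _ n] sum_negf del: uminus_mult_mat_vec)
  moreover have "S *\<^sub>v 0\<^sub>v n = 0\<^sub>v n" using S by (auto simp: mult_mat_vec_eq_iff[of _ n])
  ultimately show "v = 0\<^sub>v n"
    using mat_inverse_mult_vec[OF S inv v zero_carrier_vec]
      mat_inverse_mult_vec[OF S inv zero_carrier_vec zero_carrier_vec] by simp
qed

lemma mean_vector_iff:
  fixes S :: "real mat" and w :: "nat \<Rightarrow> real"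
  assumes S: "S \<in> carrier_mat n n" and inv: "invertible_mat S"
  shows "vec n w = the (mat_inverse (- S)) *\<^sub>v ones n \<longleftrightarrow> (\<forall>i<n. (\<Sum>j<n. S $$ (i, j) * w j) = - 1)"
proof -
  have mS: "- S \<in> carrier_mat n n" using S by simp
  have o: "ones n \<in> carrier_vec n" by (simp add: ones_def)
  have "vec n w = the (mat_inverse (- S)) *\<^sub>v ones n \<longleftrightarrow> - S *\<^sub>v vec n w = ones n"
    using mat_inverse_mult_vec[OF mS invertible_uminus_mat[OF S inv] vec_carrier o] by auto
  also have "\<dots> \<longleftrightarrow> (\<forall>i<n. (\<Sum>j<n. (- S) $$ (i, j) * vec n w $ j) = ones n $ i)"
    by (rule mult_mat_vec_eq_iff[OF mS vec_carrier o])
  also have "\<dots> \<longleftrightarrow> (\<forall>i<n. - (\<Sum>j<n. S $$ (i, j) * w j) = 1)"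
    using S by (auto simp: ones_def simp flip: sum_negf)
  finally show ?thesis by (simp add: minus_equation_iff eq_commute)
qed

lemma laplace_vector_iff:
  fixes S :: "real mat" and g :: "nat \<Rightarrow> real"
  assumes S: "subgenerator n S" and \<delta>: "0 < \<delta>"
  shows "vec n g = the (mat_inverse (\<delta> \<cdot>\<^sub>m 1\<^sub>m n - S)) *\<^sub>v exit_rates n S
    \<longleftrightarrow> (\<forall>i<n. \<delta> * g i - (\<Sum>j<n. S $$ (i, j) * g j) = - (\<Sum>j<n. S $$ (i, j)))"
proof -
  have Sc: "S \<in> carrier_mat n n" using S by (simp add: subgenerator_def)
  have A: "\<delta> \<cdot>\<^sub>m 1\<^sub>m n - S \<in> carrier_mat n n" using Sc by auto
  have "vec n g = the (mat_inverse (\<delta> \<cdot>\<^sub>m 1\<^sub>m n - S)) *\<^sub>v exit_rates n S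
      \<longleftrightarrow> (\<delta> \<cdot>\<^sub>m 1\<^sub>m n - S) *\<^sub>v vec n g = exit_rates n S"
    using mat_inverse_mult_vec[OF A resolvent_invertible[OF S \<delta>] vec_carrier exit_rates_carrier[OF Sc]]
    by auto
  also have "\<dots> \<longleftrightarrow> (\<forall>i<n. \<delta> * g i - (\<Sum>j<n. S $$ (i, j) * g j) = - (\<Sum>j<n. S $$ (i, j)))"
    unfolding mult_mat_vec_eq_iff[OF A vec_carrier exit_rates_carrier[OF Sc]]
    using resolvent_mult_vec_index[OF Sc vec_carrier, of _ \<delta> g]
    by (simp add: exit_rates_index[OF Sc])
  finally show ?thesis .
qed

lemma ph_mean_eq:
  assumes "phase_type n \<alpha> S" and "\<And>i. i < n \<Longrightarrow> (\<Sum>j<n. S $$ (i, j) * w j) = - 1"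
  shows "ph_mean n \<alpha> S = (\<Sum>i<n. \<alpha> $ i * w i)"
proof -
  have "vec n w = the (mat_inverse (- S)) *\<^sub>v ones n"
    using assms by (subst mean_vector_iff) (auto simp: phase_type_def subgenerator_def)
  then show ?thesis
    using assms(1) scalar_prod_vec_sum[of \<alpha> n w]
    by (simp add: ph_mean_def phase_type_def probability_vec_def)
qed

lemma ph_beats_probe_eq:
  assumes "phase_type n \<alpha> S" and "0 < \<delta>"
    and "\<And>i. i < n \<Longrightarrow> \<delta> * g i - (\<Sum>j<n. S $$ (i, j) * g j) = - (\<Sum>j<n. S $$ (i, j))"
  shows "ph_beats_probe \<delta> n \<alpha> S = (\<Sum>i<n. \<alpha> $ i * g i)"
proof -
  have "vec n g = the (mat_inverse (\<delta> \<cdot>\<^sub>m 1\<^sub>m n - S)) *\<^sub>v exit_rates n S"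
    using assms by (subst laplace_vector_iff) (auto simp: phase_type_def)
  then show ?thesis
    using assms(1) scalar_prod_vec_sum[of \<alpha> n g]
    by (simp add: ph_beats_probe_def phase_type_def probability_vec_def)
qed

lemma mean_vector_exists:
  assumes "phase_type n \<alpha> S"
  obtains w :: "nat \<Rightarrow> real" where "\<And>i. i < n \<Longrightarrow> (\<Sum>j<n. S $$ (i, j) * w j) = - 1"
proof -
  have S: "S \<in> carrier_mat n n" "invertible_mat S"
    using assms by (auto simp: phase_type_def subgenerator_def)
  define v where "v = the (mat_inverse (- S)) *\<^sub>v ones n"
  have "v \<in> carrier_vec n"
    using mat_inverse_invertible(1)[OF uminus_carrier_mat[OF S(1)] invertible_uminus_mat[OF S]]
    unfolding v_def by (rule mult_mat_vec_carrier) (simp add: ones_def)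
  then have "vec n (($) v) = v" by auto
  then show ?thesis using mean_vector_iff[OF S] that unfolding v_def by blast
qed

lemma laplace_vector_exists:
  assumes "phase_type n \<alpha> S" and \<delta>: "0 < \<delta>"
  obtains g :: "nat \<Rightarrow> real"
  where "\<And>i. i < n \<Longrightarrow> \<delta> * g i - (\<Sum>j<n. S $$ (i, j) * g j) = - (\<Sum>j<n. S $$ (i, j))"
proof -
  have S: "subgenerator n S" using assms by (auto simp: phase_type_def)
  then have Sc: "S \<in> carrier_mat n n" by (simp add: subgenerator_def)
  then have A: "\<delta> \<cdot>\<^sub>m 1\<^sub>m n - S \<in> carrier_mat n n" by auto
  define v where "v = the (mat_inverse (\<delta> \<cdot>\<^sub>m 1\<^sub>m n - S)) *\<^sub>v exit_rates n S"
  have "v \<in> carrier_vec n"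
    using mat_inverse_invertible(1)[OF A resolvent_invertible[OF S \<delta>]] Sc by (auto simp: v_def)
  then have "vec n (($) v) = v" by auto
  then show ?thesis using laplace_vector_iff[OF S \<delta>] that unfolding v_def by blast
qed

lemma laplace_vector_less_one:
  assumes S: "subgenerator n S" and \<delta>: "0 < \<delta>" and i: "i < n"
    and g: "\<And>i. i < n \<Longrightarrow> \<delta> * g i - (\<Sum>j<n. S $$ (i, j) * g j) = - (\<Sum>j<n. S $$ (i, j))"
  shows "g i < 1"
proof -
  have "\<delta> * (1 - g i) - (\<Sum>j<n. S $$ (i, j) * (1 - g j)) = \<delta>" if "i < n" for i
    using g[OF that] by (simp add: right_diff_distrib sum_subtractf)
  then have "0 < 1 - g i"
    using subgenerator_max_principle(2)[OF S \<delta> i, of "\<lambda>i. 1 - g i"] \<delta> by simp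
  then show ?thesis by simp
qed

lemma laplace_vector_pos:
  assumes S: "subgenerator n S" and \<delta>: "0 < \<delta>" and i: "i < n"
    and g: "\<And>i. i < n \<Longrightarrow> \<delta> * g i - (\<Sum>j<n. S $$ (i, j) * g j) = - (\<Sum>j<n. S $$ (i, j))"
    and w: "\<And>i. i < n \<Longrightarrow> (\<Sum>j<n. S $$ (i, j) * w j) = - 1"
  shows "0 < g i"
proof -
  have "exp (- (\<delta> * w i)) * (1 + \<delta> * w i - \<delta> * w i) \<le> g i"
    by (rule subgenerator_laplace_ge_tangent[OF S \<delta> i g w])
  then show ?thesis by (simp add: less_le_trans[OF exp_gt_zero])
qed

lemma ph_beats_probe_bounds:
  assumes ph: "phase_type n \<alpha> S" and \<delta>: "0 < \<delta>"
  shows "exp (- \<delta> * ph_mean n \<alpha> S) \<le> ph_beats_probe \<delta> n \<alpha> S" and "ph_beats_probe \<delta> n \<alpha> S < 1"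
proof -
  obtain w where w: "\<And>i. i < n \<Longrightarrow> (\<Sum>j<n. S $$ (i, j) * w j) = - 1"
    using mean_vector_exists[OF ph] by blast
  obtain g where g: "\<And>i. i < n \<Longrightarrow> \<delta> * g i - (\<Sum>j<n. S $$ (i, j) * g j) = - (\<Sum>j<n. S $$ (i, j))"
    using laplace_vector_exists[OF ph \<delta>] by blast
  have S: "subgenerator n S" and \<alpha>: "\<And>i. i < n \<Longrightarrow> 0 \<le> \<alpha> $ i" "(\<Sum>i<n. \<alpha> $ i) = 1"
    using ph by (auto simp: phase_type_def probability_vec_def)
  define c where "c = \<delta> * ph_mean n \<alpha> S"
  have "exp (- c) = exp (- c) * (\<Sum>i<n. \<alpha> $ i) * (1 + c)  - exp (- c) * \<delta> * (\<Sum>i<n. \<alpha> $ i * w i)"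
    using ph_mean_eq[OF ph w] \<alpha>(2) by (simp add: c_def algebra_simps)
  also have "\<dots> = (\<Sum>i<n. \<alpha> $ i * (exp (- c) * (1 + c - \<delta> * w i)))"
    by (simp add: sum_distrib_left sum_distrib_right algebra_simps sum.distrib sum_subtractf)
  also have "\<dots> \<le> (\<Sum>i<n. \<alpha> $ i * g i)"
    using \<alpha> subgenerator_laplace_ge_tangent[OF S \<delta> _ g w] by (intro sum_mono mult_left_mono) auto
  finally show "exp (- \<delta> * ph_mean n \<alpha> S) \<le> ph_beats_probe \<delta> n \<alpha> S"
    by (simp add: ph_beats_probe_eq[OF ph \<delta> g] c_def)
  obtain k where k: "k < n" "0 < \<alpha> $ k"
    using \<alpha>(2) sum_nonpos[of "{..<n}" "\<lambda>i. \<alpha> $ i"] by fastforce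
  have "(\<Sum>i<n. \<alpha> $ i * g i) < (\<Sum>i<n. \<alpha> $ i * 1)"
  proof (rule sum_strict_mono_ex1)
    show "\<forall>i\<in>{..<n}. \<alpha> $ i * g i \<le> \<alpha> $ i * 1"
    proof
      fix i assume "i \<in> {..<n}"
      then show "\<alpha> $ i * g i \<le> \<alpha> $ i * 1"
        using \<alpha>(1)[of i] laplace_vector_less_one[OF S \<delta> _ g, of i] by (intro mult_left_mono) auto
    qed
    show "\<exists>i\<in>{..<n}. \<alpha> $ i * g i < \<alpha> $ i * 1"
      using k laplace_vector_less_one[OF S \<delta> _ g] by (intro bexI[of _ k]) auto
  qed auto
  then show "ph_beats_probe \<delta> n \<alpha> S < 1"
    using \<alpha>(2) by (simp add: ph_beats_probe_eq[OF ph \<delta> g])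
qed

section \<open>The queue at the cavity\<close>

lemma stationary_distribution_expectation:
  fixes h :: "'s \<Rightarrow> real"
  assumes "stationary_distribution X r \<pi>"
  shows "(\<Sum>x\<in>X. \<pi> x * (\<Sum>z\<in>X. r x z * (h z - h x))) = 0"
proof -
  have "(\<Sum>x\<in>X. \<pi> x * (\<Sum>z\<in>X. r x z * (h z - h x)))
      = (\<Sum>x\<in>X. \<Sum>z\<in>X. \<pi> x * r x z * h z) - (\<Sum>x\<in>X. h x * (\<pi> x * (\<Sum>z\<in>X. r x z)))"
    by (simp add: right_diff_distrib sum_subtractf sum_distrib_left algebra_simps)
  also have "(\<Sum>x\<in>X. \<Sum>z\<in>X. \<pi> x * r x z * h z) = (\<Sum>z\<in>X. h z * (\<Sum>x\<in>X. \<pi> x * r x z))"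
    by (subst sum.swap) (simp add: sum_distrib_left mult.commute)
  also have "\<dots> = (\<Sum>x\<in>X. h x * (\<pi> x * (\<Sum>z\<in>X. r x z)))"
    using assms by (intro sum.cong) (auto simp: stationary_distribution_def)
  finally show ?thesis by simp
qed

lemma stationary_distribution_support_closed:
  assumes st: "stationary_distribution X r \<pi>" and "finite X"
    and r: "\<And>x z. x \<in> X \<Longrightarrow> z \<in> X \<Longrightarrow> 0 \<le> r x z"
    and "x \<in> X" and "z \<in> X" and "0 < \<pi> x" and "0 < r x z"
  shows "0 < \<pi> z"
proof (rule ccontr)
  have \<pi>: "0 \<le> \<pi> x" if "x \<in> X" for x
    using st that by (auto simp: stationary_distribution_def)
  assume "\<not> 0 < \<pi> z"
  then have "\<pi> z = 0" using \<pi>[OF \<open>z \<in> X\<close>] by simp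
  then have "(\<Sum>x\<in>X. \<pi> x * r x z) = 0"
    using st \<open>z \<in> X\<close> by (auto simp: stationary_distribution_def)
  moreover have "0 < (\<Sum>x\<in>X. \<pi> x * r x z)"
    using assms \<pi> by (intro sum_pos2[of X x]) auto
  ultimately show False by simp
qed

lemma sum_delta_level:
  fixes G :: "'j \<Rightarrow> real"
  assumes "finite E" and "e \<in> E" and "finite (Q e)" and "q \<in> Q e"
  shows "(\<Sum>e'\<in>E. \<Sum>q'\<in>Q e'. \<Sum>j\<in>J. if q' = q \<and> e' = e then G j else 0) = (\<Sum>j\<in>J. G j)"
proof -
  have "(\<Sum>q'\<in>Q e'. \<Sum>j\<in>J. if q' = q \<and> e' = e then G j else 0) = (if e' = e then \<Sum>j\<in>J. G j else 0)" for e'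
  proof (cases "e' = e")
    case True
    have "(\<Sum>q'\<in>Q e. \<Sum>j\<in>J. if q' = q then G j else 0) = (\<Sum>q'\<in>Q e. if q' = q then \<Sum>j\<in>J. G j else 0)"
      by (intro sum.cong) auto
    then show ?thesis using True assms by simp
  qed simp
  then show ?thesis using assms by simp
qed

lemma cavity_states_eq:
  "cavity_states n m = Idle ` {m, m + 1}
     \<union> (\<lambda>(e, q, j). Busy q e j) ` (SIGMA e:{m, m + 1}. {1..e} \<times> {..<n})"
  by (force simp: cavity_states_def)

lemma finite_cavity_states [simp]: "finite (cavity_states n m)"
  unfolding cavity_states_eq by (intro finite_UnI finite_imageI finite_SigmaI) auto

lemma Idle_in_cavity_states [simp]: "Idle e \<in> cavity_states n m \<longleftrightarrow> e = m \<or> e = m + 1"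
  by (auto simp: cavity_states_def)

lemma Busy_in_cavity_states [simp]:
  "Busy q e j \<in> cavity_states n m \<longleftrightarrow> (e = m \<or> e = m + 1) \<and> 1 \<le> q \<and> q \<le> e \<and> j < n"
  by (auto simp: cavity_states_def)

lemma sum_cavity_states:
  fixes F :: "cavity_state \<Rightarrow> real"
  shows "(\<Sum>x\<in>cavity_states n m. F x)
    = (\<Sum>e\<in>{m, m + 1}. F (Idle e)) + (\<Sum>e\<in>{m, m + 1}. \<Sum>q\<in>{1..e}. \<Sum>j<n. F (Busy q e j))"
proof -
  have "(\<Sum>x\<in>cavity_states n m. F x) = (\<Sum>x\<in>Idle ` {m, m + 1}. F x)
     + (\<Sum>x\<in>(\<lambda>(e, q, j). Busy q e j) ` (SIGMA e:{m, m + 1}. {1..e} \<times> {..<n}). F x)"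
    unfolding cavity_states_eq by (intro sum.union_disjoint finite_imageI finite_SigmaI) auto
  also have "(\<Sum>x\<in>Idle ` {m, m + 1}. F x) = (\<Sum>e\<in>{m, m + 1}. F (Idle e))"
    by (subst sum.reindex) (auto simp: inj_on_def)
  also have "(\<Sum>x\<in>(\<lambda>(e, q, j). Busy q e j) ` (SIGMA e:{m, m + 1}. {1..e} \<times> {..<n}). F x)
      = (\<Sum>(e, q, j)\<in>(SIGMA e:{m, m + 1}. {1..e} \<times> {..<n}). F (Busy q e j))"
    by (subst sum.reindex) (auto simp: inj_on_def case_prod_unfold)
  also have "\<dots> = (\<Sum>e\<in>{m, m + 1}. \<Sum>(q, j)\<in>{1..e} \<times> {..<n}. F (Busy q e j))"
    by (subst sum.Sigma) auto
  also have "\<dots> = (\<Sum>e\<in>{m, m + 1}. \<Sum>q\<in>{1..e}. \<Sum>j<n. F (Busy q e j))"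
    by (simp only: sum.cartesian_product)
  finally show ?thesis .
qed

locale cavity =
  fixes n m :: nat and \<alpha> :: "real vec" and S :: "real mat" and \<delta> \<nu> :: real
    and \<pi> :: "cavity_state \<Rightarrow> real" and g w :: "nat \<Rightarrow> real" and y :: real
  assumes ph: "phase_type n \<alpha> S" and \<delta>: "0 < \<delta>" and \<nu>: "0 \<le> \<nu>"
    and stationary: "stationary_distribution (cavity_states n m) (cavity_rate n \<alpha> S \<delta> m \<nu>) \<pi>"
    and g: "\<And>i. i < n \<Longrightarrow> \<delta> * g i - (\<Sum>j<n. S $$ (i, j) * g j) = - (\<Sum>j<n. S $$ (i, j))"
    and w: "\<And>i. i < n \<Longrightarrow> (\<Sum>j<n. S $$ (i, j) * w j) = - 1"
    and mean: "(\<Sum>i<n. \<alpha> $ i * w i) = 1"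
    and y: "y = (\<Sum>i<n. \<alpha> $ i * g i)"
begin

abbreviation "r \<equiv> cavity_rate n \<alpha> S \<delta> m \<nu>"

lemma S: "subgenerator n S" and S_carrier: "S \<in> carrier_mat n n"
  and \<alpha>_nonneg: "i < n \<Longrightarrow> 0 \<le> \<alpha> $ i" and \<alpha>_sum: "(\<Sum>i<n. \<alpha> $ i) = 1"
  using ph by (auto simp: phase_type_def probability_vec_def subgenerator_def)

lemma exit_eq: "i < n \<Longrightarrow> exit_rates n S $ i = - (\<Sum>j<n. S $$ (i, j))"
  by (rule exit_rates_index[OF S_carrier])

lemma rate_nonneg:
  assumes "x \<in> cavity_states n m" and "z \<in> cavity_states n m"
  shows "0 \<le> r x z"
proof -
  have "0 \<le> exit_rates n S $ i" if "i < n" for i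
    using S that by (simp add: exit_eq subgenerator_def)
  moreover have "0 \<le> S $$ (i, j)" if "i < n" "j < n" "i \<noteq> j" for i j
    using S that by (simp add: subgenerator_def)
  ultimately show ?thesis
    using assms \<delta> \<nu> \<alpha>_nonneg
    by (cases x; cases z) (auto intro!: add_nonneg_nonneg)
qed

lemma \<pi>_nonneg: "x \<in> cavity_states n m \<Longrightarrow> 0 \<le> \<pi> x"
  using stationary by (auto simp: stationary_distribution_def)

lemma support_closed:
  assumes "0 < \<pi> x" and "x \<in> cavity_states n m" and "z \<in> cavity_states n m" and "0 < r x z"
  shows "0 < \<pi> z"
  using stationary_distribution_support_closed[OF stationary finite_cavity_states rate_nonneg]
    assms by blast

lemma sum_rate_Busy:
  assumes "Busy q e j \<in> cavity_states n m"
  shows "(\<Sum>z\<in>cavity_states n m. r (Busy q e j) z * F z) =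
      (\<Sum>j'\<in>{..<n} - {j}. S $$ (j, j') * F (Busy q e j'))
    + exit_rates n S $ j * (\<Sum>j'<n. \<alpha> $ j' * (if q = 1 then F (Idle e) else F (Busy (q - 1) e j')))
    + \<delta> * F (Busy (max q m) (max q m) j)
    + (if e = m then \<nu> * F (Busy (q + 1) (m + 1) j) else 0)"
proof -
  have e: "e \<in> {m, m + 1}" and q: "1 \<le> q" "q \<le> e" and j: "j < n" using assms by auto
  let ?sum = "\<lambda>G. \<Sum>e'\<in>{m, m + 1}. \<Sum>q'\<in>{1..e'}. \<Sum>j'<n. G q' e' j'"
  let ?A = "\<lambda>q' e' j'. if q' = q \<and> e' = e then (if j' \<noteq> j then S $$ (j, j') * F (Busy q e j') else 0) else 0"
  let ?B = "\<lambda>q' e' j'. if q' = q - 1 \<and> e' = e then exit_rates n S $ j * (\<alpha> $ j' * F (Busy (q - 1) e j')) else 0"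
  let ?C = "\<lambda>q' e' j'. if q' = max q m \<and> e' = max q m
      then (if j' = j then \<delta> * F (Busy (max q m) (max q m) j') else 0) else 0"
  let ?D = "\<lambda>q' e' j'. if q' = q + 1 \<and> e' = m + 1
      then (if j' = j then (if e = m then \<nu> * F (Busy (q + 1) (m + 1) j') else 0) else 0) else 0"
  have "?sum (\<lambda>q' e' j'. r (Busy q e j) (Busy q' e' j') * F (Busy q' e' j'))
     = ?sum (\<lambda>q' e' j'. ?A q' e' j' + ?B q' e' j' + ?C q' e' j' + ?D q' e' j')"
  proof (intro sum.cong refl)
    fix q' e' j' :: nat assume "q' \<in> {1..e'}"
    then show "r (Busy q e j) (Busy q' e' j') * F (Busy q' e' j')
        = ?A q' e' j' + ?B q' e' j' + ?C q' e' j' + ?D q' e' j'"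
      unfolding cavity_rate.simps distrib_right by (intro arg_cong2[where f = "(+)"]) auto
  qed
  also have "\<dots> = ?sum ?A + ?sum ?B + ?sum ?C + ?sum ?D"
    by (simp only: sum.distrib)
  also have "?sum ?A = (\<Sum>j'<n. if j' \<noteq> j then S $$ (j, j') * F (Busy q e j') else 0)"
    using e q by (intro sum_delta_level) auto
  also have "\<dots> = (\<Sum>j'\<in>{..<n} - {j}. S $$ (j, j') * F (Busy q e j'))"
    by (intro sum.mono_neutral_cong_right) auto
  also have "?sum ?C = (\<Sum>j'<n. if j' = j then \<delta> * F (Busy (max q m) (max q m) j') else 0)"
    using e q by (intro sum_delta_level) auto
  also have "\<dots> = \<delta> * F (Busy (max q m) (max q m) j)" using j by simp
  also have "?sum ?D = (if e = m then \<nu> * F (Busy (q + 1) (m + 1) j) else 0)"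
  proof (cases "e = m")
    case True
    then have "?sum ?D = (\<Sum>j'<n. if j' = j then (if e = m then \<nu> * F (Busy (q + 1) (m + 1) j') else 0) else 0)"
      using e q by (intro sum_delta_level) auto
    then show ?thesis using j by simp
  next
    case False
    then show ?thesis by (simp cong: if_cong)
  qed
  finally have busy: "?sum (\<lambda>q' e' j'. r (Busy q e j) (Busy q' e' j') * F (Busy q' e' j'))
     = (\<Sum>j'\<in>{..<n} - {j}. S $$ (j, j') * F (Busy q e j')) + ?sum ?B
       + \<delta> * F (Busy (max q m) (max q m) j)
       + (if e = m then \<nu> * F (Busy (q + 1) (m + 1) j) else 0)" .
  have idle: "(\<Sum>e'\<in>{m, m + 1}. r (Busy q e j) (Idle e') * F (Idle e'))
     = (if q = 1 then exit_rates n S $ j * F (Idle e) else 0)"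
    using e by auto
  have "?sum ?B + (if q = 1 then exit_rates n S $ j * F (Idle e) else 0)
     = exit_rates n S $ j * (\<Sum>j'<n. \<alpha> $ j' * (if q = 1 then F (Idle e) else F (Busy (q - 1) e j')))"
  proof (cases "q = 1")
    case True
    have "?sum ?B = 0" using True by (intro sum.neutral ballI) auto
    then show ?thesis using True \<alpha>_sum by (simp flip: sum_distrib_right)
  next
    case False
    then have "?sum ?B = (\<Sum>j'<n. exit_rates n S $ j * (\<alpha> $ j' * F (Busy (q - 1) e j')))"
      using e q by (intro sum_delta_level) auto
    then show ?thesis using False by (simp add: sum_distrib_left)
  qed
  then show ?thesis unfolding sum_cavity_states busy idle by simp
qed

lemma sum_rate_Idle:
  assumes "e \<in> {m, m + 1}"
  shows "(\<Sum>z\<in>cavity_states n m. r (Idle e) z * F z) =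
      \<delta> * (\<Sum>j<n. \<alpha> $ j * (if m = 0 then F (Idle 0) else F (Busy m m j)))
    + (if e = m then \<nu> * (\<Sum>j<n. \<alpha> $ j * F (Busy 1 (m + 1) j)) else 0)"
proof -
  let ?sum = "\<lambda>G. \<Sum>e'\<in>{m, m + 1}. \<Sum>q'\<in>{1..e'}. \<Sum>j'<n. G q' e' j'"
  let ?A = "\<lambda>q' e' j'. if q' = m \<and> e' = m then (if 1 \<le> m then \<delta> * (\<alpha> $ j' * F (Busy m m j')) else 0) else 0"
  let ?B = "\<lambda>q' e' j'. if q' = 1 \<and> e' = m + 1 then (if e = m then \<nu> * (\<alpha> $ j' * F (Busy 1 (m + 1) j')) else 0) else 0"
  have "?sum (\<lambda>q' e' j'. r (Idle e) (Busy q' e' j') * F (Busy q' e' j')) = ?sum (\<lambda>q' e' j'. ?A q' e' j' + ?B q' e' j')"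
    by (intro sum.cong refl) (auto simp: algebra_simps)
  also have "\<dots> = ?sum ?A + ?sum ?B"
    by (simp only: sum.distrib)
  also have "?sum ?A = (if m = 0 then 0 else \<delta> * (\<Sum>j<n. \<alpha> $ j * F (Busy m m j)))"
  proof (cases "m = 0")
    case False
    then have "?sum ?A = (\<Sum>j'<n. if 1 \<le> m then \<delta> * (\<alpha> $ j' * F (Busy m m j')) else 0)"
      by (intro sum_delta_level) auto
    then show ?thesis using False by (simp add: sum_distrib_left)
  qed simp
  also have "?sum ?B = (\<Sum>j'<n. if e = m then \<nu> * (\<alpha> $ j' * F (Busy 1 (m + 1) j')) else 0)"
    by (intro sum_delta_level) auto
  also have "\<dots> = (if e = m then \<nu> * (\<Sum>j<n. \<alpha> $ j * F (Busy 1 (m + 1) j)) else 0)"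
    by (simp add: sum_distrib_left)
  finally have busy: "?sum (\<lambda>q' e' j'. r (Idle e) (Busy q' e' j') * F (Busy q' e' j'))
    = (if m = 0 then 0 else \<delta> * (\<Sum>j<n. \<alpha> $ j * F (Busy m m j)))
      + (if e = m then \<nu> * (\<Sum>j<n. \<alpha> $ j * F (Busy 1 (m + 1) j)) else 0)" .
  have idle: "(\<Sum>e'\<in>{m, m + 1}. r (Idle e) (Idle e') * F (Idle e')) = (if m = 0 then \<delta> * F (Idle 0) else 0)"
    by auto
  show ?thesis unfolding sum_cavity_states busy idle
    using \<alpha>_sum by (simp flip: sum_distrib_right)
qed

lemma generator_Busy:
  assumes "Busy q e j \<in> cavity_states n m"
  shows "(\<Sum>z\<in>cavity_states n m. r (Busy q e j) z * (h z - h (Busy q e j))) =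
      (\<Sum>j'<n. S $$ (j, j') * h (Busy q e j'))
    + exit_rates n S $ j * (\<Sum>j'<n. \<alpha> $ j' * (if q = 1 then h (Idle e) else h (Busy (q - 1) e j')))
    + \<delta> * (h (Busy (max q m) (max q m) j) - h (Busy q e j))
    + (if e = m then \<nu> * (h (Busy (q + 1) (m + 1) j) - h (Busy q e j)) else 0)"
proof -
  let ?a = "h (Busy q e j)"
  have j: "j < n" using assms by simp
  have "(\<Sum>j'\<in>{..<n} - {j}. S $$ (j, j') * (h (Busy q e j') - ?a))
      = (\<Sum>j'<n. S $$ (j, j') * (h (Busy q e j') - ?a))"
    using j by (intro sum.mono_neutral_left) auto
  also have "\<dots> = (\<Sum>j'<n. S $$ (j, j') * h (Busy q e j')) + exit_rates n S $ j * ?a"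
    by (simp add: right_diff_distrib sum_subtractf exit_eq[OF j] sum_distrib_right)
  finally have 1: "(\<Sum>j'\<in>{..<n} - {j}. S $$ (j, j') * (h (Busy q e j') - ?a))
     = (\<Sum>j'<n. S $$ (j, j') * h (Busy q e j')) + exit_rates n S $ j * ?a" .
  have "(\<Sum>j'<n. \<alpha> $ j' * (if q = 1 then h (Idle e) - ?a else h (Busy (q - 1) e j') - ?a))
     = (\<Sum>j'<n. \<alpha> $ j' * (if q = 1 then h (Idle e) else h (Busy (q - 1) e j')) - \<alpha> $ j' * ?a)"
    by (intro sum.cong) (auto simp: algebra_simps)
  also have "\<dots> = (\<Sum>j'<n. \<alpha> $ j' * (if q = 1 then h (Idle e) else h (Busy (q - 1) e j'))) - ?a"
    using \<alpha>_sum by (simp add: sum_subtractf flip: sum_distrib_right)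
  finally have 2: "(\<Sum>j'<n. \<alpha> $ j' * (if q = 1 then h (Idle e) - ?a else h (Busy (q - 1) e j') - ?a))
     = (\<Sum>j'<n. \<alpha> $ j' * (if q = 1 then h (Idle e) else h (Busy (q - 1) e j'))) - ?a" .
  show ?thesis unfolding sum_rate_Busy[OF assms] 1 2 by (simp add: algebra_simps)
qed

lemma generator_Idle:
  assumes "e \<in> {m, m + 1}"
  shows "(\<Sum>z\<in>cavity_states n m. r (Idle e) z * (h z - h (Idle e))) =
      \<delta> * ((\<Sum>j<n. \<alpha> $ j * (if m = 0 then h (Idle 0) else h (Busy m m j))) - h (Idle e))
    + (if e = m then \<nu> * ((\<Sum>j<n. \<alpha> $ j * h (Busy 1 (m + 1) j)) - h (Idle e)) else 0)"
proof -
  have "(\<Sum>j<n. \<alpha> $ j * (if m = 0 then h (Idle 0) - h (Idle e) else h (Busy m m j) - h (Idle e)))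
     = (\<Sum>j<n. \<alpha> $ j * (if m = 0 then h (Idle 0) else h (Busy m m j)) - \<alpha> $ j * h (Idle e))"
    by (intro sum.cong) (auto simp: algebra_simps)
  then show ?thesis unfolding sum_rate_Idle[OF assms]
    using \<alpha>_sum by (simp add: right_diff_distrib sum_subtractf flip: sum_distrib_right)
qed

lemma exit_eq_g: "j < n \<Longrightarrow> (\<Sum>j'<n. S $$ (j, j') * g j') = \<delta> * g j - exit_rates n S $ j"
  using g[of j] by (simp add: exit_eq)

lemma g_pos: "j < n \<Longrightarrow> 0 < g j"
  by (rule laplace_vector_pos[OF S \<delta> _ g w])

lemma g_nonneg: "j < n \<Longrightarrow> 0 \<le> g j"
  using g_pos by (rule less_imp_le)

lemma y_eq: "y = ph_beats_probe \<delta> n \<alpha> S"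
  using ph_beats_probe_eq[OF ph \<delta> g] y by simp

lemma y_bounds: "0 < y" "y < 1"
  using ph_beats_probe_bounds[OF ph \<delta>] by (auto simp: y_eq intro: less_le_trans[OF exp_gt_zero])

lemma expectation_generator:
  "(\<Sum>e\<in>{m, m + 1}. \<pi> (Idle e) * (\<Sum>z\<in>cavity_states n m. r (Idle e) z * (h z - h (Idle e))))
   + (\<Sum>e\<in>{m, m + 1}. \<Sum>q\<in>{1..e}. \<Sum>j<n. \<pi> (Busy q e j) *
        (\<Sum>z\<in>cavity_states n m. r (Busy q e j) z * (h z - h (Busy q e j)))) = 0"
  using stationary_distribution_expectation[OF stationary, of h] unfolding sum_cavity_states[of _ n m] .

text \<open>Stationarity is tested against the function \<open>h\<close> below. It is invariant under the \<open>\<nu>\<close>-transitions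
  (in the mean, when they start a service), so that \<open>\<nu>\<close> drops out, and the recursion
  \<open>\<kappa> (k + 1) = y * \<kappa> k - 1\<close>, \<open>\<kappa> m = 0\<close> makes the generator equal to \<open>1\<close> on all busy states.\<close>

lemma idle_balance:
  assumes X: "X = 1 / y"
  shows "1 - (\<pi> (Idle m) + \<pi> (Idle (m + 1)))
    = \<delta> * (\<pi> (Idle m) * ((X ^ m - 1) / (X - 1)) + \<pi> (Idle (m + 1)) * ((X ^ (m + 1) - 1) / (X - 1)))"
proof -
  have X1: "1 < X" using y_bounds by (simp add: X)
  have yX: "y * X = 1" using y_bounds by (simp add: X)
  define \<kappa> where "\<kappa> k = (X ^ (m + 1 - k) - X) / (X - 1)" for k
  have \<kappa>_m: "\<kappa> m = 0" by (simp add: \<kappa>_def)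
  have \<kappa>_end: "\<kappa> (m + 1) = - 1" using X1 by (simp add: \<kappa>_def field_simps)
  have \<kappa>_step: "\<kappa> k * y - 1 = \<kappa> (Suc k)" if "k \<le> m" for k
  proof -
    have "X ^ (m + 1 - k) * y = X ^ (m + 1 - Suc k)"
      using that yX by (simp add: Suc_diff_le mult.assoc mult.commute[of X])
    moreover have "X * y = 1" using yX by (simp add: mult.commute)
    ultimately have "\<kappa> k * y = (X ^ (m + 1 - Suc k) - 1) / (X - 1)"
      by (simp add: \<kappa>_def left_diff_distrib)
    then show ?thesis using X1 by (simp add: \<kappa>_def field_simps)
  qed
  have \<kappa>_idle: "\<kappa> (m + 1 - e) + 1 = (X ^ e - 1) / (X - 1)" if "e \<le> m + 1" for e
    using that X1 by (simp add: \<kappa>_def field_simps)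
  define h where "h x = (case x of Idle e \<Rightarrow> \<kappa> (m + 1 - e) | Busy q e j \<Rightarrow> \<kappa> (q + m - e) * g j - w j)" for x
  have h: "h (Idle e) = \<kappa> (m + 1 - e)" "h (Busy q e j) = \<kappa> (q + m - e) * g j - w j" for e q j
    by (auto simp: h_def)
  have avg: "(\<Sum>j<n. \<alpha> $ j * (c * g j - w j)) = c * y - 1" for c
    using mean by (simp add: y right_diff_distrib sum_subtractf sum_distrib_left algebra_simps)
  have gen_busy: "(\<Sum>z\<in>cavity_states n m. r (Busy q e j) z * (h z - h (Busy q e j))) = 1"
    if x: "Busy q e j \<in> cavity_states n m" for q e j
  proof -
    define k where "k = q + m - e"
    have j: "j < n" and e: "e = m \<or> e = m + 1" and q: "1 \<le> q" "q \<le> e" using x by auto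
    have phase: "(\<Sum>j'<n. S $$ (j, j') * h (Busy q e j')) = \<kappa> k * (\<delta> * g j - exit_rates n S $ j) + 1"
      using w[OF j] by (simp add: h k_def right_diff_distrib sum_subtractf algebra_simps flip: exit_eq_g[OF j])
        (simp add: sum_distrib_left algebra_simps)
    have service: "(\<Sum>j'<n. \<alpha> $ j' * (if q = 1 then h (Idle e) else h (Busy (q - 1) e j'))) = \<kappa> k"
    proof (cases "q = 1")
      case True
      then show ?thesis using \<alpha>_sum by (simp add: h k_def add.commute flip: sum_distrib_right)
    next
      case False
      then have "Suc (q - 1 + m - e) = k" "q - 1 + m - e \<le> m" using q e by (auto simp: k_def)
      then show ?thesis using False \<kappa>_step[of "q - 1 + m - e"] by (simp add: h avg)
    qed
    have probe: "h (Busy (max q m) (max q m) j) - h (Busy q e j) = - \<kappa> k * g j"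
    proof (cases "q = m + 1")
      case True
      then have "e = m + 1" using e q by auto
      then show ?thesis using True by (simp add: h k_def \<kappa>_m)
    next
      case False
      then have "max q m = m" using e q by auto
      then show ?thesis by (simp add: h k_def \<kappa>_m)
    qed
    have "h (Busy (q + 1) (m + 1) j) - h (Busy q e j) = 0" if "e = m"
      using that by (simp add: h k_def)
    then show ?thesis unfolding generator_Busy[OF x] phase service probe
      by (cases "e = m") (simp_all add: algebra_simps)
  qed
  have gen_idle: "(\<Sum>z\<in>cavity_states n m. r (Idle e) z * (h z - h (Idle e))) = - \<delta> * ((X ^ e - 1) / (X - 1))"
    if e: "e \<in> {m, m + 1}" for e
  proof -
    have "(\<Sum>j<n. \<alpha> $ j * (if m = 0 then h (Idle 0) else h (Busy m m j))) = - 1"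
    proof (cases "m = 0")
      case True
      then show ?thesis using \<alpha>_sum \<kappa>_end by (simp add: h sum_negf)
    next
      case False
      then show ?thesis using avg[of 0] by (simp add: h \<kappa>_m)
    qed
    moreover have "(\<Sum>j<n. \<alpha> $ j * h (Busy 1 (m + 1) j)) - h (Idle m) = 0"
      using \<kappa>_step[of 0] by (simp add: h avg)
    moreover have "e \<le> m + 1" using e by auto
    ultimately show ?thesis
      unfolding generator_Idle[OF e] by (auto simp: h algebra_simps simp flip: \<kappa>_idle)
  qed
  define A where "A e = (X ^ e - 1) / (X - 1)" for e
  have "(\<Sum>e\<in>{m, m + 1}. \<pi> (Idle e) * (- \<delta> * A e))
     + (\<Sum>e\<in>{m, m + 1}. \<Sum>q\<in>{1..e}. \<Sum>j<n. \<pi> (Busy q e j) * 1) = 0"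
  proof -
    have "(\<Sum>e\<in>{m, m + 1}. \<pi> (Idle e) * (- \<delta> * A e)) =
      (\<Sum>e\<in>{m, m + 1}. \<pi> (Idle e) * (\<Sum>z\<in>cavity_states n m. r (Idle e) z * (h z - h (Idle e))))"
      by (intro sum.cong refl) (simp only: gen_idle A_def)
    moreover have "(\<Sum>e\<in>{m, m + 1}. \<Sum>q\<in>{1..e}. \<Sum>j<n. \<pi> (Busy q e j) * 1) =
      (\<Sum>e\<in>{m, m + 1}. \<Sum>q\<in>{1..e}. \<Sum>j<n. \<pi> (Busy q e j) *
        (\<Sum>z\<in>cavity_states n m. r (Busy q e j) z * (h z - h (Busy q e j))))"
      by (intro sum.cong refl) (subst gen_busy, auto)
    ultimately show ?thesis using expectation_generator[of h] by linarith
  qed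
  moreover have "(\<Sum>e\<in>{m, m + 1}. \<pi> (Idle e)) + (\<Sum>e\<in>{m, m + 1}. \<Sum>q\<in>{1..e}. \<Sum>j<n. \<pi> (Busy q e j)) = 1"
    using stationary unfolding stationary_distribution_def sum_cavity_states by blast
  ultimately show ?thesis by (simp add: algebra_simps flip: A_def power_Suc)
qed

text \<open>Balance of the probability of emptying the queue before the next probe when the estimate is
  \<open>m + 1\<close>.\<close>

lemma top_level_balance:
  "\<delta> * \<pi> (Idle (m + 1)) = \<delta> * y ^ m * (\<Sum>j<n. \<pi> (Busy (m + 1) (m + 1) j) * g j)
     + \<nu> * (\<pi> (Idle m) * y + (\<Sum>q\<in>{1..m}. \<Sum>j<n. \<pi> (Busy q m j) * (y ^ q * g j)))"
proof -
  define h where "h x = (case x of Idle e \<Rightarrow> if e = m + 1 then 1 else 0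
    | Busy q e j \<Rightarrow> if e = m + 1 then y ^ (q - 1) * g j else 0)" for x
  have h: "h (Idle e) = (if e = m + 1 then 1 else 0)"
    "h (Busy q e j) = (if e = m + 1 then y ^ (q - 1) * g j else 0)" for e q j
    by (auto simp: h_def)
  have avg: "(\<Sum>j<n. \<alpha> $ j * (c * g j)) = c * y" for c
    by (simp add: y sum_distrib_left algebra_simps)
  have gen_m: "(\<Sum>z\<in>cavity_states n m. r (Busy q m j) z * (h z - h (Busy q m j))) = \<nu> * (y ^ q * g j)"
    if "q \<in> {1..m}" "j < n" for q j
  proof -
    have x: "Busy q m j \<in> cavity_states n m" and "max q m = m" using that by auto
    then show ?thesis unfolding generator_Busy[OF x] by (simp add: h cong: if_cong)
  qed
  have gen_top: "(\<Sum>z\<in>cavity_states n m. r (Busy q (m + 1) j) z * (h z - h (Busy q (m + 1) j)))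
      = (if q = m + 1 then \<delta> * y ^ m * g j else 0)"
    if "q \<in> {1..m + 1}" "j < n" for q j
  proof -
    have x: "Busy q (m + 1) j \<in> cavity_states n m" using that by auto
    have "(\<Sum>j'<n. S $$ (j, j') * h (Busy q (m + 1) j')) = y ^ (q - 1) * (\<delta> * g j - exit_rates n S $ j)"
      by (simp add: h sum_distrib_left algebra_simps flip: exit_eq_g[OF \<open>j < n\<close>])
    moreover have "(\<Sum>j'<n. \<alpha> $ j' * (if q = 1 then h (Idle (m + 1)) else h (Busy (q - 1) (m + 1) j'))) = y ^ (q - 1)"
    proof (cases "q = 1")
      case True
      then show ?thesis using \<alpha>_sum by (simp add: h)
    next
      case False
      define k where "k = q - 2"
      have "q = Suc (Suc k)" using that False by (auto simp: k_def)
      then show ?thesis using avg[of "y ^ k"] by (simp add: h mult.commute)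
    qed
    moreover have "h (Busy (max q m) (max q m) j) = (if q = m + 1 then y ^ m * g j else 0)"
      using that by (auto simp: h max_def)
    moreover have "h (Busy q (m + 1) j) = y ^ (q - 1) * g j" by (simp add: h)
    ultimately show ?thesis unfolding generator_Busy[OF x] by (simp add: algebra_simps)
  qed
  have gen_idle_m: "(\<Sum>z\<in>cavity_states n m. r (Idle m) z * (h z - h (Idle m))) = \<nu> * y"
    using avg[of 1] by (subst generator_Idle) (simp_all add: h cong: if_cong)
  have gen_idle_top: "(\<Sum>z\<in>cavity_states n m. r (Idle (m + 1)) z * (h z - h (Idle (m + 1)))) = - \<delta>"
    by (subst generator_Idle) (simp_all add: h cong: if_cong)
  have "(\<Sum>q\<in>{1..m}. \<Sum>j<n. \<pi> (Busy q m j) *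
        (\<Sum>z\<in>cavity_states n m. r (Busy q m j) z * (h z - h (Busy q m j))))
      = (\<Sum>q\<in>{1..m}. \<Sum>j<n. \<pi> (Busy q m j) * (\<nu> * (y ^ q * g j)))"
    using gen_m by (intro sum.cong refl) (simp only: lessThan_iff)
  moreover have "(\<Sum>q\<in>{1..m + 1}. \<Sum>j<n. \<pi> (Busy q (m + 1) j) *
        (\<Sum>z\<in>cavity_states n m. r (Busy q (m + 1) j) z * (h z - h (Busy q (m + 1) j))))
      = (\<Sum>q\<in>{1..m + 1}. \<Sum>j<n. \<pi> (Busy q (m + 1) j) * (if q = m + 1 then \<delta> * y ^ m * g j else 0))"
    using gen_top by (intro sum.cong refl) (simp only: lessThan_iff)
  moreover have "(\<Sum>q\<in>{1..m + 1}. \<Sum>j<n. \<pi> (Busy q (m + 1) j) * (if q = m + 1 then \<delta> * y ^ m * g j else 0))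
      = (\<Sum>j<n. \<pi> (Busy (m + 1) (m + 1) j) * (\<delta> * y ^ m * g j))"
  proof -
    have "(\<Sum>q\<in>{1..m}. \<Sum>j<n. \<pi> (Busy q (m + 1) j) * (if q = m + 1 then \<delta> * y ^ m * g j else 0)) = 0"
      by (intro sum.neutral ballI) auto
    then show ?thesis by simp
  qed
  ultimately have "\<pi> (Idle m) * (\<nu> * y) - \<pi> (Idle (m + 1)) * \<delta>
      + ((\<Sum>q\<in>{1..m}. \<Sum>j<n. \<pi> (Busy q m j) * (\<nu> * (y ^ q * g j)))
      + (\<Sum>j<n. \<pi> (Busy (m + 1) (m + 1) j) * (\<delta> * y ^ m * g j))) = 0"
    using expectation_generator[of h] gen_idle_m gen_idle_top by simp
  then show ?thesis by (simp add: sum_distrib_left algebra_simps)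
qed

lemma queue_length_prob_pos_iff:
  "0 < queue_length_prob n m \<pi> q \<longleftrightarrow> (\<exists>x\<in>cavity_states n m. queue_length x = q \<and> 0 < \<pi> x)"
proof
  assume "0 < queue_length_prob n m \<pi> q"
  then show "\<exists>x\<in>cavity_states n m. queue_length x = q \<and> 0 < \<pi> x"
    using sum_nonpos[of "{x \<in> cavity_states n m. queue_length x = q}" \<pi>]
    unfolding queue_length_prob_def by fastforce
next
  assume "\<exists>x\<in>cavity_states n m. queue_length x = q \<and> 0 < \<pi> x"
  then obtain x where "x \<in> cavity_states n m" "queue_length x = q" "0 < \<pi> x" by blast
  then show "0 < queue_length_prob n m \<pi> q"
    unfolding queue_length_prob_def using \<pi>_nonneg by (intro sum_pos2[of _ x]) auto
qed

lemma queue_length_prob_zero: "queue_length_prob n m \<pi> 0 = \<pi> (Idle m) + \<pi> (Idle (m + 1))"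
proof -
  have "{x \<in> cavity_states n m. queue_length x = 0} = Idle ` {m, m + 1}"
    by (auto simp: cavity_states_def)
  then show ?thesis unfolding queue_length_prob_def by (simp add: sum.reindex)
qed

lemma initial_phase: obtains j where "j < n" "0 < \<alpha> $ j"
  using \<alpha>_sum sum_nonpos[of "{..<n}" "\<lambda>j. \<alpha> $ j"] by fastforce

lemma probe_reaches_level_m:
  assumes "e \<in> {m, m + 1}" and "0 < \<pi> (Idle e)" and "1 \<le> m" and "j < n" and "0 < \<alpha> $ j"
  shows "0 < \<pi> (Busy m m j)"
  by (rule support_closed[of "Idle e"]) (use assms \<delta> in simp_all)

lemma max_queue_length_eq:
  assumes pos: "0 < \<pi> (Idle m) + \<pi> (Idle (m + 1))"
  shows "max_queue_length n m \<pi> = (if \<pi> (Idle (m + 1)) = 0 then m else m + 1)"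
proof -
  let ?Q = "{q. 0 < queue_length_prob n m \<pi> q}"
  have le: "q \<le> m + 1" if "q \<in> ?Q" for q
    using that by (auto simp: queue_length_prob_pos_iff cavity_states_def)
  then have fin: "finite ?Q" by (intro finite_subset[of ?Q "{..m + 1}"]) auto
  obtain j where j: "j < n" "0 < \<alpha> $ j" using initial_phase .
  show ?thesis
  proof (cases "\<pi> (Idle (m + 1)) = 0")
    case True
    then have idle: "0 < \<pi> (Idle m)" using pos by simp
    have "m \<in> ?Q"
    proof (cases "m = 0")
      case True
      then show ?thesis using pos queue_length_prob_zero by simp
    next
      case False
      then show ?thesis
        using probe_reaches_level_m[of m j] idle j
        by (auto simp: queue_length_prob_pos_iff intro!: bexI[of _ "Busy m m j"])
    qed
    moreover have "m + 1 \<notin> ?Q"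
    proof
      assume "m + 1 \<in> ?Q"
      then obtain i where i: "i < n" "0 < \<pi> (Busy (m + 1) (m + 1) i)"
        by (auto simp: queue_length_prob_pos_iff cavity_states_def)
      have "0 < (\<Sum>j<n. \<pi> (Busy (m + 1) (m + 1) j) * g j)"
        using i g_pos g_nonneg \<pi>_nonneg by (intro sum_pos2[of _ i]) auto
      then have "0 < \<delta> * y ^ m * (\<Sum>j<n. \<pi> (Busy (m + 1) (m + 1) j) * g j)"
        using \<delta> y_bounds by simp
      moreover have "0 \<le> \<nu> * (\<pi> (Idle m) * y + (\<Sum>q\<in>{1..m}. \<Sum>j<n. \<pi> (Busy q m j) * (y ^ q * g j)))"
        using \<nu> y_bounds g_nonneg \<pi>_nonneg
        by (intro mult_nonneg_nonneg add_nonneg_nonneg sum_nonneg) auto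
      ultimately show False using top_level_balance True by simp
    qed
    ultimately have "Max ?Q = m"
      using fin
    proof (intro Max_eqI)
      fix q assume "q \<in> ?Q"
      with le[OF this] \<open>m + 1 \<notin> ?Q\<close> show "q \<le> m" by (cases "q = m + 1") auto
    qed
    then show ?thesis using True by (simp add: max_queue_length_def)
  next
    case False
    then have idle: "0 < \<pi> (Idle (m + 1))" using \<pi>_nonneg[of "Idle (m + 1)"] by simp
    have "\<exists>i<n. 0 < \<pi> (Busy (m + 1) (m + 1) i)"
    proof (cases "\<nu> = 0")
      case True
      then have "0 < \<delta> * y ^ m * (\<Sum>j<n. \<pi> (Busy (m + 1) (m + 1) j) * g j)"
        using mult_pos_pos[OF \<delta> idle] unfolding top_level_balance by simp
      then have "0 < (\<Sum>j<n. \<pi> (Busy (m + 1) (m + 1) j) * g j)"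
        by (rule zero_less_mult_pos) (simp add: \<delta> y_bounds)
      then have "\<exists>i<n. 0 < \<pi> (Busy (m + 1) (m + 1) i) * g i"
        using sum_nonpos[of "{..<n}" "\<lambda>j. \<pi> (Busy (m + 1) (m + 1) j) * g j"] by fastforce
      then show ?thesis using g_pos zero_less_mult_pos2 by blast
    next
      case False
      then have \<nu>_pos: "0 < \<nu>" using \<nu> by simp
      have "0 < \<pi> (Busy (m + 1) (m + 1) j)"
      proof (cases "m = 0")
        case True
        have "0 < \<pi> (Idle 0)"
          by (rule support_closed[of "Idle 1"]) (use True idle \<delta> in auto)
        show ?thesis
          by (rule support_closed[of "Idle 0"]) (use True \<open>0 < \<pi> (Idle 0)\<close> j \<nu>_pos in auto)
      next
        case False
        then have "0 < \<pi> (Busy m m j)" using probe_reaches_level_m[of "m + 1" j] idle j by simp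
        show ?thesis
          by (rule support_closed[of "Busy m m j"])
            (use False \<open>0 < \<pi> (Busy m m j)\<close> j \<nu>_pos in auto)
      qed
      then show ?thesis using j by blast
    qed
    then have "m + 1 \<in> ?Q"
      by (force simp: queue_length_prob_pos_iff)
    then have "Max ?Q = m + 1"
      using le fin by (intro Max_eqI) auto
    then show ?thesis using False by (simp add: max_queue_length_def)
  qed
qed

end

section \<open>The bounds\<close>

lemma m_tilde_eq_log:
  assumes "phase_type n \<alpha> S" and "0 < \<delta>" and y: "y = ph_beats_probe \<delta> n \<alpha> S"
  shows "m_tilde lam \<delta> n \<alpha> S = log (1 / y) (1 + lam / ((1 - lam) * \<delta>) * (1 / y - 1))"
proof -
  have "0 < y"
    using ph_beats_probe_bounds(1)[OF assms(1,2)] less_le_trans[OF exp_gt_zero] unfolding y by blast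
  then have "1 / y + (U - 1) * ((1 - y) / y) = 1 + U * (1 / y - 1)" for U
    by (simp add: field_simps)
  then show ?thesis
    unfolding m_tilde_def Let_def log_def y[symmetric] by (simp only: mult.commute[of \<delta>])
qed

lemma ceiling_m_tilde_eq_max_queue_length:
  assumes ph: "phase_type n \<alpha> S" and mean: "ph_mean n \<alpha> S = 1"
    and cav: "queue_at_the_cavity lam \<delta> n \<alpha> S m \<nu> \<pi>"
    and "lam < 1" and \<delta>: "0 < \<delta>"
  shows "int (max_queue_length n m \<pi>) = \<lceil>m_tilde lam \<delta> n \<alpha> S\<rceil>"
proof -
  obtain w where w: "\<And>i. i < n \<Longrightarrow> (\<Sum>j<n. S $$ (i, j) * w j) = - 1"
    using mean_vector_exists[OF ph] by blast
  obtain g where g: "\<And>i. i < n \<Longrightarrow> \<delta> * g i - (\<Sum>j<n. S $$ (i, j) * g j) = - (\<Sum>j<n. S $$ (i, j))"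
    using laplace_vector_exists[OF ph \<delta>] by blast
  define y where "y = (\<Sum>i<n. \<alpha> $ i * g i)"
  interpret cavity n m \<alpha> S \<delta> \<nu> \<pi> g w y
    using cav mean ph_mean_eq[OF ph w]
    by unfold_locales (auto simp: ph \<delta> g w y_def queue_at_the_cavity_def)
  define X where "X = 1 / y"
  define U where "U = lam / ((1 - lam) * \<delta>)"
  define z where "z = \<pi> (Idle (m + 1))"
  have X1: "1 < X" using y_bounds by (simp add: X_def)
  have idle: "\<pi> (Idle m) + z = 1 - lam"
    using cav queue_length_prob_zero by (simp add: queue_at_the_cavity_def z_def)
  have z: "0 \<le> z" "z \<le> 1 - lam"
    using \<pi>_nonneg[of "Idle m"] \<pi>_nonneg[of "Idle (m + 1)"] idle by (auto simp: z_def)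
  have "lam = 1 - (\<pi> (Idle m) + \<pi> (Idle (m + 1)))" using idle by (simp add: z_def)
  also have "\<dots> = \<delta> * (\<pi> (Idle m) * ((X ^ m - 1) / (X - 1)) + \<pi> (Idle (m + 1)) * ((X ^ (m + 1) - 1) / (X - 1)))"
    by (rule idle_balance[OF X_def])
  also have "\<dots> = \<delta> * ((1 - lam - z) * ((X ^ m - 1) / (X - 1)) + z * ((X ^ (m + 1) - 1) / (X - 1)))"
    using idle by (simp add: z_def flip: idle)
  also have "\<dots> = \<delta> * (((1 - lam) * (X ^ m - 1) + z * (X ^ (m + 1) - X ^ m)) / (X - 1))"
    by (simp add: add_divide_distrib diff_divide_distrib algebra_simps)
  finally have "lam * (X - 1) = \<delta> * ((1 - lam) * (X ^ m - 1) + z * (X ^ (m + 1) - X ^ m))"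
    using X1 by (simp add: field_simps)
  then have "U * (X - 1) = ((1 - lam) * (X ^ m - 1) + z * (X ^ (m + 1) - X ^ m)) / (1 - lam)"
    using \<delta> by (simp add: U_def mult.commute[of _ \<delta>])
  also have "\<dots> = (X ^ m - 1) + z / (1 - lam) * (X ^ (m + 1) - X ^ m)"
    using \<open>lam < 1\<close> by (subst add_divide_distrib) simp
  finally have key: "1 + U * (X - 1) = X ^ m + z / (1 - lam) * (X ^ (m + 1) - X ^ m)"
    by simp
  have m_tilde: "m_tilde lam \<delta> n \<alpha> S = log X (1 + U * (X - 1))"
    unfolding X_def U_def by (rule m_tilde_eq_log[OF ph \<delta> y_eq])
  have pow: "log X (X ^ k) = real k" for k using X1 by (simp add: log_nat_power)
  have max: "max_queue_length n m \<pi> = (if z = 0 then m else m + 1)"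
    unfolding z_def using max_queue_length_eq idle \<open>lam < 1\<close> by (simp add: z_def)
  show ?thesis
  proof (cases "z = 0")
    case True
    then have "m_tilde lam \<delta> n \<alpha> S = real m" unfolding m_tilde key by (simp add: pow)
    then show ?thesis using max True by simp
  next
    case False
    have Xm: "0 < X ^ m" "X ^ m < X ^ (m + 1)" using X1 by simp_all
    have "0 < z / (1 - lam)" "z / (1 - lam) \<le> 1" using z False \<open>lam < 1\<close> by auto
    then have "0 < z / (1 - lam) * (X ^ (m + 1) - X ^ m)"
      using Xm by (intro mult_pos_pos) auto
    moreover have "z / (1 - lam) * (X ^ (m + 1) - X ^ m) \<le> 1 * (X ^ (m + 1) - X ^ m)"
      using Xm \<open>z / (1 - lam) \<le> 1\<close> by (intro mult_right_mono) auto
    ultimately have bounds: "X ^ m < 1 + U * (X - 1)" "1 + U * (X - 1) \<le> X ^ (m + 1)"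
      unfolding key mult_1 by linarith+
    have "log X (X ^ m) < log X (1 + U * (X - 1))"
      using bounds X1 Xm(1) by (subst log_less_cancel_iff) linarith+
    moreover have "log X (1 + U * (X - 1)) \<le> log X (X ^ (m + 1))"
      using bounds X1 Xm by (subst log_le_cancel_iff) linarith+
    ultimately have "\<lceil>m_tilde lam \<delta> n \<alpha> S\<rceil> = int m + 1"
      unfolding m_tilde pow by (intro ceiling_unique) auto
    then show ?thesis using max False by simp
  qed
qed

lemma powr_le_tangent_at_one:
  fixes u t :: real
  assumes "0 < u" and "0 \<le> t" and "t \<le> 1"
  shows "u powr t \<le> 1 + t * (u - 1)"
  using Youngs_inequality_0[of t "1 - t" u 1] assms by (simp add: algebra_simps)

lemma log_one_plus_le:
  fixes U x :: real
  assumes "1 \<le> U" and "1 < x"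
  shows "log x (1 + U * (x - 1)) \<le> U"
proof -
  have A: "0 < 1 + U * (x - 1)" using assms by (simp add: add_pos_nonneg)
  have "(1 + U * (x - 1)) powr (1 / U) \<le> 1 + 1 / U * ((1 + U * (x - 1)) - 1)"
    using assms A by (intro powr_le_tangent_at_one) auto
  also have "\<dots> = x" using assms by simp
  finally have "((1 + U * (x - 1)) powr (1 / U)) powr U \<le> x powr U"
    using assms by (intro powr_mono2) auto
  then have "1 + U * (x - 1) \<le> x powr U" using assms A by (simp add: powr_powr)
  then have "log x (1 + U * (x - 1)) \<le> log x (x powr U)"
    using assms A by (subst log_le_cancel_iff) auto
  then show ?thesis using assms by simp
qed

text \<open>With \<open>x = E powr t\<close> and \<open>A = 1 + U * (E - 1)\<close> the claim reads \<open>A powr t \<le> 1 + U * (E powr t - 1)\<close>;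
  since \<open>E\<close> is the average of \<open>A\<close> and \<open>1\<close> with weights \<open>1 / U\<close> and \<open>1 - 1 / U\<close>, this is concavity of
  \<open>\<lambda>z. z powr t\<close>.\<close>

lemma log_one_plus_antimono:
  fixes U x E :: real
  assumes "1 \<le> U" and "1 < x" and "x \<le> E"
  shows "log E (1 + U * (E - 1)) \<le> log x (1 + U * (x - 1))"
proof -
  define A where "A = 1 + U * (E - 1)"
  define t where "t = log E x"
  have E: "1 < E" using assms by simp
  have t: "0 < t" "t \<le> 1" using assms E by (auto simp: t_def)
  have x: "x = E powr t" using assms E by (simp add: t_def)
  have A: "1 \<le> A" using assms by (simp add: A_def)
  have "(A / E) powr t \<le> 1 + t * (A / E - 1)" "(1 / E) powr t \<le> 1 + t * (1 / E - 1)"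
    using A E t by (auto intro!: powr_le_tangent_at_one)
  then have "(A / E) powr t + (U - 1) * (1 / E) powr t
      \<le> (1 + t * (A / E - 1)) + (U - 1) * (1 + t * (1 / E - 1))"
    using assms by (intro add_mono mult_left_mono) auto
  also have "\<dots> = U" using E by (simp add: A_def field_simps)
  finally have "(A powr t + (U - 1)) / E powr t \<le> U"
    using A E by (simp add: powr_divide add_divide_distrib)
  then have "A powr t \<le> 1 + U * (x - 1)" using E unfolding x by (simp add: field_simps)
  then have "log x (A powr t) \<le> log x (1 + U * (x - 1))"
    using assms A by (subst log_le_cancel_iff) (auto intro: add_pos_nonneg)
  moreover have "log x (A powr t) = log E A"
  proof -
    have "ln x = t * ln E" unfolding x using E by (simp add: ln_powr)
    then show ?thesis using t A by (simp add: log_def ln_powr)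
  qed
  ultimately show ?thesis by (simp add: A_def)
qed

lemma ceiling_log_one_plus_small:
  fixes U x :: real
  assumes "0 \<le> U" and "U \<le> 1" and "1 < x"
  shows "\<lceil>log x (1 + U * (x - 1))\<rceil> = \<lceil>U\<rceil>"
proof (cases "U = 0")
  case False
  then have "0 < U * (x - 1)" using assms by simp
  moreover have "U * (x - 1) \<le> 1 * (x - 1)" using assms by (intro mult_right_mono) auto
  ultimately have "1 < 1 + U * (x - 1)" "1 + U * (x - 1) \<le> x" by auto
  then have "0 < log x (1 + U * (x - 1))" "log x (1 + U * (x - 1)) \<le> 1" using assms by auto
  then have "\<lceil>log x (1 + U * (x - 1))\<rceil> = 1" by (intro ceiling_unique) auto
  moreover have "\<lceil>U\<rceil> = 1" using False assms by (intro ceiling_unique) auto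
  ultimately show ?thesis by simp
qed simp

lemma tendsto_log_one_plus_at_one:
  fixes U :: real
  assumes "0 \<le> U"
  shows "((\<lambda>y. log (1 / y) (1 + U * (1 / y - 1))) \<longlongrightarrow> U) (at_left 1)"
  using assms unfolding log_def
  by (cases "U = 0") (simp, real_asymp)

section \<open>Tightness\<close>

lemma invertible_upper_triangular:
  fixes A :: "real mat"
  assumes A: "A \<in> carrier_mat n n" and "upper_triangular A" and "\<And>i. i < n \<Longrightarrow> A $$ (i, i) \<noteq> 0"
  shows "invertible_mat A"
proof -
  have "det A = prod_list (diag_mat A)" by (rule det_upper_triangular[OF assms(2) A])
  also have "\<dots> \<noteq> 0" using A assms(3) by (auto simp: diag_mat_def prod_list_zero_iff)
  finally show ?thesis
    using det_non_zero_imp_unit[OF A, of "()"] A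
    by (auto simp: Units_def ring_mat_simps invertible_mat_def inverts_mat_def)
qed

lemma erlang_phase_type:
  assumes k: "0 < k" and \<delta>: "0 < \<delta>"
  obtains \<alpha> S where "phase_type k \<alpha> S" and "ph_mean k \<alpha> S = 1"
    and "ph_beats_probe \<delta> k \<alpha> S = 1 / (1 + \<delta> / real k) ^ k"
proof -
  define \<alpha> :: "real vec" where "\<alpha> = unit_vec k 0"
  define S :: "real mat" where
    "S = mat k k (\<lambda>(i, j). if j = i then - real k else if j = Suc i then real k else 0)"
  have Sc: "S \<in> carrier_mat k k" by (simp add: S_def)
  have S_sum: "(\<Sum>j<k. S $$ (i, j) * f j) = real k * ((if Suc i < k then f (Suc i) else 0) - f i)"
    if "i < k" for i and f :: "nat \<Rightarrow> real"
  proof -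
    have "(\<Sum>j<k. S $$ (i, j) * f j)
       = (\<Sum>j<k. (if j = Suc i then real k * f (Suc i) else 0) - (if j = i then real k * f i else 0))"
      using that by (intro sum.cong) (auto simp: S_def)
    then show ?thesis using that by (simp add: sum_subtractf algebra_simps)
  qed
  have row: "(\<Sum>j<k. S $$ (i, j)) = (if Suc i < k then 0 else - real k)" if "i < k" for i
    using S_sum[OF that, of "\<lambda>_. 1"] by auto
  have "invertible_mat S"
    by (rule invertible_upper_triangular[OF Sc]) (use k in \<open>auto simp: S_def\<close>)
  moreover have "subgenerator k S"
    unfolding subgenerator_def using Sc row by (auto simp: S_def)
  moreover have "probability_vec k \<alpha>"
    using k by (auto simp: probability_vec_def \<alpha>_def unit_vec_def)
  ultimately have ph: "phase_type k \<alpha> S" by (simp add: phase_type_def)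
  have first: "(\<Sum>i<k. \<alpha> $ i * f i) = f 0" for f :: "nat \<Rightarrow> real"
  proof -
    have "(\<Sum>i<k. \<alpha> $ i * f i) = (\<Sum>i<k. if i = 0 then f 0 else 0)"
      using k by (intro sum.cong) (auto simp: \<alpha>_def)
    then show ?thesis using k by simp
  qed
  have "ph_mean k \<alpha> S = (\<Sum>i<k. \<alpha> $ i * ((real k - real i) / real k))"
  proof (rule ph_mean_eq[OF ph])
    fix i assume i: "i < k"
    have "(if Suc i < k then (real k - real (Suc i)) / real k else 0) = (real k - real (Suc i)) / real k"
      using i by (cases "Suc i = k") auto
    then show "(\<Sum>j<k. S $$ (i, j) * ((real k - real j) / real k)) = - 1"
      unfolding S_sum[OF i] by (simp only:) (use k in \<open>simp add: field_simps\<close>)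
  qed
  then have "ph_mean k \<alpha> S = 1" unfolding first using k by simp
  moreover
  define a where "a = 1 / (1 + \<delta> / real k)"
  have a: "(\<delta> + real k) * a = real k"
    using k \<delta> by (simp add: a_def field_simps)
  have "ph_beats_probe \<delta> k \<alpha> S = (\<Sum>i<k. \<alpha> $ i * a ^ (k - i))"
  proof (rule ph_beats_probe_eq[OF ph \<delta>])
    fix i assume i: "i < k"
    then have "a ^ (k - i) = a * a ^ (k - Suc i)" by (simp add: Suc_diff_Suc flip: power_Suc)
    then have "(\<delta> + real k) * a ^ (k - i) = real k * a ^ (k - Suc i)"
      using a by (simp flip: mult.assoc)
    then show "\<delta> * a ^ (k - i) - (\<Sum>j<k. S $$ (i, j) * a ^ (k - j)) = - (\<Sum>j<k. S $$ (i, j))"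
      unfolding S_sum[OF i] row[OF i] using i
      by (cases "Suc i = k") (auto simp: algebra_simps)
  qed
  then have "ph_beats_probe \<delta> k \<alpha> S = 1 / (1 + \<delta> / real k) ^ k"
    unfolding first by (simp add: a_def power_one_over)
  ultimately show ?thesis using that ph by blast
qed

text \<open>With probability \<open>1 - \<epsilon>\<close> the job size has mean \<open>\<epsilon> / (1 - \<epsilon>)\<close>, with probability \<open>\<epsilon>\<close> it has
  mean \<open>(1 - \<epsilon>) / \<epsilon>\<close>.\<close>

lemma hyperexponential_phase_type:
  assumes \<epsilon>: "0 < \<epsilon>" "\<epsilon> < 1" and \<delta>: "0 < \<delta>"
  obtains \<alpha> S where "phase_type 2 \<alpha> S" and "ph_mean 2 \<alpha> S = 1"
    and "(1 - \<epsilon>) * ((1 - \<epsilon>) / (1 - \<epsilon> + \<epsilon> * \<delta>)) \<le> ph_beats_probe \<delta> 2 \<alpha> S"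
proof -
  define p where "p i = (if i = 0 then 1 - \<epsilon> else \<epsilon>)" for i :: nat
  define \<mu> where "\<mu> i = p i / (1 - p i)" for i
  have p: "0 < p i" "p i < 1" for i using \<epsilon> by (auto simp: p_def)
  then have \<mu>: "0 < \<mu> i" for i by (simp add: \<mu>_def)
  define \<alpha> :: "real vec" where "\<alpha> = vec 2 p"
  define S :: "real mat" where "S = mat 2 2 (\<lambda>(i, j). if j = i then - \<mu> i else 0)"
  have Sc: "S \<in> carrier_mat 2 2" by (simp add: S_def)
  have S_sum: "(\<Sum>j<2. S $$ (i, j) * f j) = - \<mu> i * f i" if "i < 2" for i and f :: "nat \<Rightarrow> real"
  proof -
    have "(\<Sum>j<2. S $$ (i, j) * f j) = (\<Sum>j<2. if j = i then - \<mu> i * f i else 0)"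
      using that by (intro sum.cong) (auto simp: S_def)
    then show ?thesis using that by simp
  qed
  have row: "(\<Sum>j<2. S $$ (i, j)) = - \<mu> i" if "i < 2" for i
    using S_sum[OF that, of "\<lambda>_. 1"] by simp
  have two: "(\<Sum>i<2. f i) = f 0 + f 1" for f :: "nat \<Rightarrow> real"
    by (simp add: numeral_2_eq_2)
  have "invertible_mat S"
    by (rule invertible_upper_triangular[OF Sc]) (use \<mu> in \<open>auto simp: S_def less_imp_neq[symmetric]\<close>)
  moreover have "subgenerator 2 S"
    unfolding subgenerator_def using Sc row \<mu> by (auto simp: S_def less_imp_le)
  moreover have "probability_vec 2 \<alpha>"
    using p by (auto simp: probability_vec_def \<alpha>_def two less_imp_le) (simp add: p_def)
  ultimately have ph: "phase_type 2 \<alpha> S" by (simp add: phase_type_def)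
  have "ph_mean 2 \<alpha> S = (\<Sum>i<2. \<alpha> $ i * (1 / \<mu> i))"
  proof (rule ph_mean_eq[OF ph])
    fix i :: nat assume i: "i < 2"
    show "(\<Sum>j<2. S $$ (i, j) * (1 / \<mu> j)) = - 1"
      unfolding S_sum[OF i] using \<mu>[of i] by simp
  qed
  also have "\<dots> = 1" unfolding two using \<epsilon> by (simp add: \<alpha>_def \<mu>_def p_def)
  finally have mean: "ph_mean 2 \<alpha> S = 1" .
  have "ph_beats_probe \<delta> 2 \<alpha> S = (\<Sum>i<2. \<alpha> $ i * (\<mu> i / (\<mu> i + \<delta>)))"
  proof (rule ph_beats_probe_eq[OF ph \<delta>])
    fix i :: nat assume i: "i < 2"
    have "(\<mu> i + \<delta>) * (\<mu> i / (\<mu> i + \<delta>)) = \<mu> i" using \<mu>[of i] \<delta> by simp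
    then show "\<delta> * (\<mu> i / (\<mu> i + \<delta>)) - (\<Sum>j<2. S $$ (i, j) * (\<mu> j / (\<mu> j + \<delta>))) = - (\<Sum>j<2. S $$ (i, j))"
      unfolding S_sum[OF i] row[OF i] by (simp only: distrib_right)
  qed
  also have "\<dots> \<ge> \<alpha> $ 0 * (\<mu> 0 / (\<mu> 0 + \<delta>))"
    unfolding two using p \<mu> \<delta> by (simp add: \<alpha>_def less_imp_le add_nonneg_nonneg)
  also have "\<alpha> $ 0 * (\<mu> 0 / (\<mu> 0 + \<delta>)) = (1 - \<epsilon>) * ((1 - \<epsilon>) / (1 - \<epsilon> + \<epsilon> * \<delta>))"
  proof -
    have "\<mu> 0 = (1 - \<epsilon>) / \<epsilon>" "\<mu> 0 + \<delta> = (1 - \<epsilon> + \<epsilon> * \<delta>) / \<epsilon>"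
      using \<epsilon> by (simp_all add: \<mu>_def p_def add_divide_distrib)
    then show ?thesis using \<epsilon> by (simp add: \<alpha>_def p_def)
  qed
  finally show ?thesis using that ph mean by blast
qed

lemma phase_type_beats_probe_near_one:
  assumes \<delta>: "0 < \<delta>" and "b < 1"
  obtains n \<alpha> S where "phase_type n \<alpha> S" and "ph_mean n \<alpha> S = 1" and "b < ph_beats_probe \<delta> n \<alpha> S"
proof -
  have "((\<lambda>\<epsilon>. (1 - \<epsilon>) * ((1 - \<epsilon>) / (1 - \<epsilon> + \<epsilon> * \<delta>))) \<longlongrightarrow> (1 - 0) * ((1 - 0) / (1 - 0 + 0 * \<delta>))) (at_right 0)"
    by (intro tendsto_intros) auto
  then have "eventually (\<lambda>\<epsilon>. b < (1 - \<epsilon>) * ((1 - \<epsilon>) / (1 - \<epsilon> + \<epsilon> * \<delta>))) (at_right 0)"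
    using \<open>b < 1\<close> by (intro order_tendstoD(1)) auto
  moreover have "eventually (\<lambda>\<epsilon>::real. 0 < \<epsilon> \<and> \<epsilon> < 1) (at_right 0)"
    using eventually_at_right_real[of 0 1] by simp
  ultimately have "eventually (\<lambda>\<epsilon>. b < (1 - \<epsilon>) * ((1 - \<epsilon>) / (1 - \<epsilon> + \<epsilon> * \<delta>)) \<and> 0 < \<epsilon> \<and> \<epsilon> < 1) (at_right 0)"
    by eventually_elim simp
  then obtain \<epsilon> where \<epsilon>: "b < (1 - \<epsilon>) * ((1 - \<epsilon>) / (1 - \<epsilon> + \<epsilon> * \<delta>))" "0 < \<epsilon>" "\<epsilon> < 1"
    using eventually_happens'[OF trivial_limit_at_right_real] by blast
  show ?thesis
  proof (rule hyperexponential_phase_type[OF \<epsilon>(2,3) \<delta>])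
    fix \<alpha> S
    assume "phase_type 2 \<alpha> S" "ph_mean 2 \<alpha> S = 1"
      "(1 - \<epsilon>) * ((1 - \<epsilon>) / (1 - \<epsilon> + \<epsilon> * \<delta>)) \<le> ph_beats_probe \<delta> 2 \<alpha> S"
    then show thesis using \<epsilon>(1) that by (meson less_le_trans)
  qed
qed

lemma phase_type_beats_probe_near_exp:
  assumes \<delta>: "0 < \<delta>" and "exp (- \<delta>) < b"
  obtains n \<alpha> S where "phase_type n \<alpha> S" and "ph_mean n \<alpha> S = 1" and "ph_beats_probe \<delta> n \<alpha> S < b"
proof -
  have "(\<lambda>k. 1 / (1 + \<delta> / real k) ^ k) \<longlonglongrightarrow> 1 / exp \<delta>"
    by (intro tendsto_divide tendsto_const tendsto_exp_limit_sequentially) simp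
  then have "eventually (\<lambda>k. 1 / (1 + \<delta> / real k) ^ k < b) sequentially"
    using assms by (intro order_tendstoD(2)) (auto simp: exp_minus field_simps)
  then have "eventually (\<lambda>k. 1 / (1 + \<delta> / real k) ^ k < b \<and> 0 < k) sequentially"
    using eventually_gt_at_top[of 0] by eventually_elim simp
  then obtain k where "1 / (1 + \<delta> / real k) ^ k < b" "0 < k"
    using eventually_happens'[OF sequentially_bot] by blast
  then show ?thesis using erlang_phase_type[of k \<delta>] \<delta> that by metis
qed

theorem theorem4p7:
  fixes lam \<delta> L U :: real
  assumes "0 \<le> lam" and "lam < 1" and "0 < \<delta>"
    and L: "L = (1 / \<delta>) * ln (1 + (1 / \<delta>) * (lam / (1 - lam)) * (exp \<delta> - 1))"
    and U: "U = lam / ((1 - lam) * \<delta>)"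
  shows
    \<comment> \<open>the maximum queue length of the queue at the cavity and its bounds\<close>
    "(\<forall>n \<alpha> S. phase_type n \<alpha> S \<and> ph_mean n \<alpha> S = 1 \<longrightarrow>
        (\<forall>m \<nu> \<pi>. queue_at_the_cavity lam \<delta> n \<alpha> S m \<nu> \<pi> \<longrightarrow>
            int (max_queue_length n m \<pi>) = \<lceil>m_tilde lam \<delta> n \<alpha> S\<rceil>)
        \<and> \<lceil>L\<rceil> \<le> \<lceil>m_tilde lam \<delta> n \<alpha> S\<rceil>
        \<and> \<lceil>m_tilde lam \<delta> n \<alpha> S\<rceil> \<le> \<lceil>U\<rceil>)
     \<comment> \<open>tightness of the upper bound\<close>
     \<and> (\<exists>n \<alpha> S. phase_type n \<alpha> S \<and> ph_mean n \<alpha> S = 1 \<and> \<lceil>m_tilde lam \<delta> n \<alpha> S\<rceil> = \<lceil>U\<rceil>)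
     \<and> (\<forall>\<epsilon>>0. \<exists>n \<alpha> S. phase_type n \<alpha> S \<and> ph_mean n \<alpha> S = 1 \<and> \<bar>m_tilde lam \<delta> n \<alpha> S - U\<bar> < \<epsilon>)
     \<comment> \<open>tightness of the lower bound; the ceiling of an integer \<open>L \<ge> 2\<close> is reached only in the limit,
       because then \<open>m_tilde\<close> exceeds \<open>L\<close> for every phase-type distribution\<close>
     \<and> (L \<notin> \<int> \<or> L \<le> 1 \<longrightarrow>
          (\<exists>n \<alpha> S. phase_type n \<alpha> S \<and> ph_mean n \<alpha> S = 1 \<and> \<lceil>m_tilde lam \<delta> n \<alpha> S\<rceil> = \<lceil>L\<rceil>))
     \<and> (\<forall>\<epsilon>>0. \<exists>n \<alpha> S. phase_type n \<alpha> S \<and> ph_mean n \<alpha> S = 1 \<and> \<bar>m_tilde lam \<delta> n \<alpha> S - L\<bar> < \<epsilon>)"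
proof -
  define E where "E = exp \<delta>"
  have E: "1 < E" using \<open>0 < \<delta>\<close> by (simp add: E_def)
  have U0: "0 \<le> U" using assms by simp
  define f where "f y = log (1 / y) (1 + U * (1 / y - 1))" for y
  have L_log: "L = log E (1 + U * (E - 1))"
    unfolding L U E_def log_def by (simp add: mult.commute)
  then have f_exp: "f (exp (- \<delta>)) = L"
    by (simp add: f_def E_def exp_minus inverse_eq_divide)
  have m_tilde: "m_tilde lam \<delta> n \<alpha> S = f (ph_beats_probe \<delta> n \<alpha> S)" if "phase_type n \<alpha> S" for n \<alpha> S
    unfolding f_def U by (rule m_tilde_eq_log[OF that \<open>0 < \<delta>\<close> refl])
  have X: "1 < 1 / ph_beats_probe \<delta> n \<alpha> S" "1 / ph_beats_probe \<delta> n \<alpha> S \<le> E"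
    and y: "exp (- \<delta>) \<le> ph_beats_probe \<delta> n \<alpha> S" "ph_beats_probe \<delta> n \<alpha> S < 1"
    if "phase_type n \<alpha> S" "ph_mean n \<alpha> S = 1" for n \<alpha> S
  proof -
    show y: "exp (- \<delta>) \<le> ph_beats_probe \<delta> n \<alpha> S" "ph_beats_probe \<delta> n \<alpha> S < 1"
      using ph_beats_probe_bounds[OF that(1) \<open>0 < \<delta>\<close>] that(2) by auto
    have "0 < ph_beats_probe \<delta> n \<alpha> S" by (rule less_le_trans[OF exp_gt_zero y(1)])
    then show "1 < 1 / ph_beats_probe \<delta> n \<alpha> S" "1 / ph_beats_probe \<delta> n \<alpha> S \<le> E"
      using y by (auto simp: E_def exp_minus field_simps)
  qed
  have small: "\<lceil>m_tilde lam \<delta> n \<alpha> S\<rceil> = \<lceil>U\<rceil>" "\<lceil>L\<rceil> = \<lceil>U\<rceil>"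
    if "U \<le> 1" "phase_type n \<alpha> S" "ph_mean n \<alpha> S = 1" for n \<alpha> S
    unfolding L_log m_tilde[OF that(2)] f_def
    using ceiling_log_one_plus_small[OF U0 \<open>U \<le> 1\<close>] X[OF that(2,3)] E by auto
  have large: "L \<le> m_tilde lam \<delta> n \<alpha> S" "m_tilde lam \<delta> n \<alpha> S \<le> U"
    if "1 \<le> U" "phase_type n \<alpha> S" "ph_mean n \<alpha> S = 1" for n \<alpha> S
    unfolding L_log m_tilde[OF that(2)] f_def
    using log_one_plus_antimono[OF that(1)] log_one_plus_le[OF that(1)] X[OF that(2,3)] by auto
  have near_U: "\<exists>n \<alpha> S. phase_type n \<alpha> S \<and> ph_mean n \<alpha> S = 1 \<and> \<bar>m_tilde lam \<delta> n \<alpha> S - U\<bar> < \<epsilon>"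
    if "0 < \<epsilon>" for \<epsilon>
  proof -
    have "eventually (\<lambda>y. dist (f y) U < \<epsilon>) (at_left 1)"
      using tendsto_log_one_plus_at_one[OF U0] \<open>0 < \<epsilon>\<close> unfolding f_def by (rule tendstoD)
    then obtain b where b: "b < 1" "\<And>y. b < y \<Longrightarrow> y < 1 \<Longrightarrow> dist (f y) U < \<epsilon>"
      using eventually_at_left[of "0 :: real" 1] by auto
    obtain n \<alpha> S where ph: "phase_type n \<alpha> S" "ph_mean n \<alpha> S = 1" "b < ph_beats_probe \<delta> n \<alpha> S"
      using phase_type_beats_probe_near_one[OF \<open>0 < \<delta>\<close> b(1)] by blast
    then show ?thesis using b(2) y[OF ph(1,2)] m_tilde[OF ph(1)] by (metis dist_real_def)
  qed
  have near_L: "\<exists>n \<alpha> S. phase_type n \<alpha> S \<and> ph_mean n \<alpha> S = 1 \<and> \<bar>m_tilde lam \<delta> n \<alpha> S - L\<bar> < \<epsilon>"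
    if "0 < \<epsilon>" for \<epsilon>
  proof -
    have pos: "0 < 1 + U * (1 / exp (- \<delta>) - 1)"
      using U0 \<open>0 < \<delta>\<close> by (intro add_pos_nonneg mult_nonneg_nonneg) auto
    have "(f \<longlongrightarrow> f (exp (- \<delta>))) (at_right (exp (- \<delta>)))"
      unfolding f_def log_def using pos \<open>0 < \<delta>\<close>
      by (intro tendsto_intros) auto
    then have "eventually (\<lambda>y. dist (f y) L < \<epsilon>) (at_right (exp (- \<delta>)))"
      using \<open>0 < \<epsilon>\<close> unfolding f_exp by (rule tendstoD)
    then obtain b where b: "exp (- \<delta>) < b" "\<And>y. exp (- \<delta>) < y \<Longrightarrow> y < b \<Longrightarrow> dist (f y) L < \<epsilon>"
      using eventually_at_right[of "exp (- \<delta>)" 1] \<open>0 < \<delta>\<close> by auto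
    obtain n \<alpha> S where ph: "phase_type n \<alpha> S" "ph_mean n \<alpha> S = 1" "ph_beats_probe \<delta> n \<alpha> S < b"
      using phase_type_beats_probe_near_exp[OF \<open>0 < \<delta>\<close> b(1)] by blast
    have "dist (f (ph_beats_probe \<delta> n \<alpha> S)) L < \<epsilon>"
      using b(2) ph(3) y(1)[OF ph(1,2)] f_exp \<open>0 < \<epsilon>\<close>
      by (cases "ph_beats_probe \<delta> n \<alpha> S = exp (- \<delta>)") auto
    then show ?thesis using ph(1,2) m_tilde[OF ph(1)] by (metis dist_real_def)
  qed
  have "\<exists>n \<alpha> S. phase_type n \<alpha> S \<and> ph_mean n \<alpha> S = 1 \<and> \<lceil>m_tilde lam \<delta> n \<alpha> S\<rceil> = \<lceil>U\<rceil>"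
  proof (cases "U \<le> 1")
    case True
    obtain n \<alpha> S where "phase_type n \<alpha> S" "ph_mean n \<alpha> S = 1" using near_U[of 1] by auto
    then show ?thesis using small(1)[OF True] by blast
  next
    case False
    obtain n \<alpha> S where ph: "phase_type n \<alpha> S" "ph_mean n \<alpha> S = 1"
      and "\<bar>m_tilde lam \<delta> n \<alpha> S - U\<bar> < U - (of_int \<lceil>U\<rceil> - 1)"
      using near_U[of "U - (of_int \<lceil>U\<rceil> - 1)"] ceiling_correct[of U] by auto
    then have "\<lceil>m_tilde lam \<delta> n \<alpha> S\<rceil> = \<lceil>U\<rceil>"
      using large(2)[OF _ ph] False ceiling_correct[of U] by (intro ceiling_unique) linarith+
    then show ?thesis using ph by blast
  qed
  moreover have "\<exists>n \<alpha> S. phase_type n \<alpha> S \<and> ph_mean n \<alpha> S = 1 \<and> \<lceil>m_tilde lam \<delta> n \<alpha> S\<rceil> = \<lceil>L\<rceil>"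
    if cond: "L \<notin> \<int> \<or> L \<le> 1"
  proof (cases "U \<le> 1")
    case True
    obtain n \<alpha> S where "phase_type n \<alpha> S" "ph_mean n \<alpha> S = 1" using near_U[of 1] by auto
    then show ?thesis using small[OF True] by metis
  next
    case False
    have "1 * (E - 1) < U * (E - 1)" using False E by (intro mult_strict_right_mono) auto
    then have "E < 1 + U * (E - 1)" by (simp add: algebra_simps)
    then have "1 < L" unfolding L_log using E by (subst less_log_iff) auto
    then have "L \<noteq> of_int \<lceil>L\<rceil>" using cond by (metis Ints_of_int linorder_not_le)
    then have "L < of_int \<lceil>L\<rceil>" using ceiling_correct[of L] by linarith
    then obtain n \<alpha> S where ph: "phase_type n \<alpha> S" "ph_mean n \<alpha> S = 1"
      and "\<bar>m_tilde lam \<delta> n \<alpha> S - L\<bar> < of_int \<lceil>L\<rceil> - L"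
      using near_L[of "of_int \<lceil>L\<rceil> - L"] by auto
    then have "\<lceil>m_tilde lam \<delta> n \<alpha> S\<rceil> = \<lceil>L\<rceil>"
      using large(1)[OF _ ph] False ceiling_correct[of L] by (intro ceiling_unique) linarith+
    then show ?thesis using ph by blast
  qed
  moreover have "\<lceil>L\<rceil> \<le> \<lceil>m_tilde lam \<delta> n \<alpha> S\<rceil> \<and> \<lceil>m_tilde lam \<delta> n \<alpha> S\<rceil> \<le> \<lceil>U\<rceil>"
    if "phase_type n \<alpha> S" "ph_mean n \<alpha> S = 1" for n \<alpha> S
    using small[OF _ that] large[OF _ that] by (cases "U \<le> 1") (auto intro: ceiling_mono)
  ultimately show ?thesis
    using near_U near_L ceiling_m_tilde_eq_max_queue_length \<open>lam < 1\<close> \<open>0 < \<delta>\<close> by blast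
qed

end
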